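(* Let $n\ge 1$. For any orientation $\mathscr A$ of the Coxeter graph $\Gamma_{n-1}$ of $S_n$, the center of gravity of the associahedron $\mathrm{Asso}_{\mathscr A}(S_n)\subset\mathbb R^n$ is $G=\left(\frac{n+1}{2},\frac{n+1}{2},\dots,\frac{n+1}{2}\right)\in\mathbb R^n$; that is, $\sum_{T\in\mathcal T_{n+2}}\left(M_{\mathscr A}(T)-G\right)=0$.
   Context: Write $[n]=\{1,\dots,n\}$. Let $P$ be a regular $(n+2)$-gon in the Euclidean plane with vertices $A_0,A_1,\dots,A_{n+1}$ in counterclockwise order. A triangle of $P$ is a triangle whose vertices are vertices of $P$ (so each of its sides is an edge or a diagonal of $P$). A triangulation $T$ of $P$ is a collection of $n$ distinct triangles of $P$ with pairwise noncrossing sides (equivalently, a set of $n-1$ pairwise noncrossing diagonals cutting $P$ into $n$ triangles). $\mathcal T_{n+2}$ is the set of all triangulations of $P$. The Coxeter graph $\Gamma_{n-1}$ of $S_n$ is the path with vertices $\tau_1,\dots,\tau_{n-1}$ (the simple transpositions $\tau_i=(i,\,i+1)$) and edges $\{\tau_{i-1},\tau_i\}$, $2\le i\le n-1$. Let $\mathscr A$ be an orientation of $\Gamma_{n-1}$. An element $i\in\{2,\dots,n-1\}$ is up if the edge $\{\tau_{i-1},\tau_i\}$ is directed from $\tau_i$ to $\tau_{i-1}$, and down otherwise; $1$ and $n$ are set to be down. Let $\mathsf D_{\mathscr A}$ and $\mathsf U_{\mathscr A}$ be the sets of down and up elements of $[n]$. Label the vertices of $P$ by $0,1,\dots,n+1$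 as follows: $A_0$ is labeled $0$, and then, going counterclockwise from $A_0$, the vertices are labeled by the down elements in increasing order, then by $n+1$, then by the up elements in decreasing order. For $l\in[n]$ and $T\in\mathcal T_{n+2}$ there is a unique triangle $\Delta_l^{\mathscr A}(T)$ of $T$ whose vertices are labeled $k<l<m$. Its weight $\omega_l^{\mathscr A}(T)$ is the product of the number of edges of the boundary path of $P$ from the vertex labeled $l$ to the vertex labeled $k$ passing only through vertices labeled by numbers $\le l$, and the number of edges of the boundary path of $P$ from the vertex labeled $l$ to the vertex labeled $m$ passing only through vertices labeled by numbers $\ge l$. Set $x_j^{\mathscr A}(T)=\omega_j^{\mathscr A}(T)$ if $j\in\mathsf D_{\mathscr A}$ and $x_j^{\mathscr A}(T)=n+1-\omega_j^{\mathscr A}(T)$ if $j\in\mathsf U_{\mathscr A}$, and $M_{\mathscr A}(T)=(x_1^{\mathscr A}(T),\dots,x_n^{\mathscr A}(T))\in\mathbb R^n$. The map $M_{\mathscr A}$ is injective. $\mathrm{Asso}_{\mathscr A}(S_n)$ is the convex hull of $\{M_{\mathscr A}(T)\mid T\in\mathcal T_{n+2}\}$, and these points are its vertices. The center of gravity (isobarycenter) of this polytope is the isobarycenter of its vertices, i.e. the unique point $G\in\mathbb R^n$ with $\sum_{T\in\mathcal T_{n+2}}(M_{\mathscr A}(T)-G)=0$. *)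

theory Defs
  imports "HOL-Analysis.Analysis" "HOL-Combinatorics.Transposition"
begin

subsection \<open>Orientations of the Coxeter graph of the symmetric group\<close>

definition simple_transposition :: "nat \<Rightarrow> nat \<Rightarrow> nat" where
  "simple_transposition i = Transposition.transpose i (i + 1)"

text \<open>The edge set of the path with vertices \<open>\<tau>\<^sub>1, \<dots>, \<tau>\<^bsub>n-1\<^esub>\<close>.\<close>

definition coxeter_edges :: "nat \<Rightarrow> (nat \<Rightarrow> nat) set set" where
  "coxeter_edges n = {{simple_transposition (i - 1), simple_transposition i} |i. i \<in> {2..n - 1}}"

definition orientation_of :: "'v set set \<Rightarrow> ('v \<times> 'v) set \<Rightarrow> bool" where
  "orientation_of E \<A> \<longleftrightarrow>
     (\<forall>(u, v) \<in> \<A>. {u, v} \<in> E) \<and>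
     (\<forall>u v. {u, v} \<in> E \<longrightarrow> ((u, v) \<in> \<A> \<longleftrightarrow> (v, u) \<notin> \<A>))"

type_synonym orientation = "((nat \<Rightarrow> nat) \<times> (nat \<Rightarrow> nat)) set"

definition up_elements :: "nat \<Rightarrow> orientation \<Rightarrow> nat set" where
  "up_elements n \<A> =
     {i \<in> {2..n - 1}. (simple_transposition i, simple_transposition (i - 1)) \<in> \<A>}"

definition down_elements :: "nat \<Rightarrow> orientation \<Rightarrow> nat set" where
  "down_elements n \<A> = {1..n} - up_elements n \<A>"

subsection \<open>Triangulations of a regular polygon\<close>

text \<open>
  \<open>A 0, \<dots>, A (N - 1)\<close> are the vertices, in counterclockwise order, of a regular \<open>N\<close>-gon with
  centre \<open>c\<close> and circumradius \<open>r\<close> in the plane.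
\<close>

definition regular_polygon :: "nat \<Rightarrow> (nat \<Rightarrow> complex) \<Rightarrow> bool" where
  "regular_polygon N A \<longleftrightarrow>
     (\<exists>c r \<theta>. r > 0 \<and> (\<forall>j<N. A j = c + of_real r * cis (\<theta> + 2 * pi * real j / real N)))"

text \<open>A triangle is represented by the set of the indices \<open>j\<close> of its three vertices \<open>A j\<close>.\<close>

definition polygon_triangles :: "nat \<Rightarrow> nat set set" where
  "polygon_triangles N = {t. t \<subseteq> {..<N} \<and> card t = 3}"

text \<open>
  Distinct sides do not cross if their relative interiors are disjoint (they may share an endpoint).
  For \<open>a = b\<close> the open segment is empty, so the degenerate pairs below impose nothing.
\<close>

definition noncrossing_sides :: "(nat \<Rightarrow> complex) \<Rightarrow> nat set \<Rightarrow> nat set \<Rightarrow> bool" where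
  "noncrossing_sides A s t \<longleftrightarrow>
     (\<forall>a\<in>s. \<forall>b\<in>s. \<forall>c\<in>t. \<forall>d\<in>t. {a, b} \<noteq> {c, d} \<longrightarrow>
        open_segment (A a) (A b) \<inter> open_segment (A c) (A d) = {})"

definition triangulations :: "nat \<Rightarrow> (nat \<Rightarrow> complex) \<Rightarrow> nat set set set" where
  "triangulations n A =
     {T. T \<subseteq> polygon_triangles (n + 2) \<and> card T = n \<and>
         (\<forall>s\<in>T. \<forall>t\<in>T. noncrossing_sides A s t)}"

subsection \<open>The vertex labelling\<close>

text \<open>\<open>vertex_label n \<A> j\<close> is the label of the vertex \<open>A j\<close>, for \<open>j < n + 2\<close>.\<close>

definition vertex_label :: "nat \<Rightarrow> orientation \<Rightarrow> nat \<Rightarrow> nat" where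
  "vertex_label n \<A> j =
     ([0] @ sorted_list_of_set (down_elements n \<A>) @ [n + 1]
        @ rev (sorted_list_of_set (up_elements n \<A>))) ! j"

definition vertex_labelled :: "nat \<Rightarrow> orientation \<Rightarrow> nat \<Rightarrow> nat" where
  "vertex_labelled n \<A> l = (THE j. j < n + 2 \<and> vertex_label n \<A> j = l)"

subsection \<open>Weights and the points of the associahedron\<close>

definition middle_triangle :: "nat \<Rightarrow> orientation \<Rightarrow> nat set set \<Rightarrow> nat \<Rightarrow> nat set" where
  "middle_triangle n \<A> T l =
     (THE t. t \<in> T \<and> (\<exists>k m. k < l \<and> l < m \<and> vertex_label n \<A> ` t = {k, l, m}))"

text \<open>
  A path along the boundary of the \<open>N\<close>-gon from the vertex \<open>v\<close> to the vertex \<open>w\<close>, given by the list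
  of its vertices; it runs either counterclockwise or clockwise throughout.
\<close>

definition boundary_path :: "nat \<Rightarrow> nat \<Rightarrow> nat \<Rightarrow> nat list \<Rightarrow> bool" where
  "boundary_path N v w p \<longleftrightarrow>
     p \<noteq> [] \<and> hd p = v \<and> last p = w \<and> distinct p \<and>
     (successively (\<lambda>a b. b = (a + 1) mod N) p \<or> successively (\<lambda>a b. a = (b + 1) mod N) p)"

text \<open>
  The number of edges of the boundary path from the vertex labelled \<open>l\<close> to the vertex labelled \<open>k\<close>
  through vertices whose labels satisfy \<open>Q\<close>. In the two uses below exactly one of the two boundary
  paths qualifies, because the other one contains the vertex labelled \<open>n + 1\<close> or \<open>0\<close>.
\<close>

definition boundary_edges ::
  "nat \<Rightarrow> orientation \<Rightarrow> nat \<Rightarrow> nat \<Rightarrow> (nat \<Rightarrow> bool) \<Rightarrow> nat" where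
  "boundary_edges n \<A> l k Q =
     (THE d. \<exists>p. boundary_path (n + 2) (vertex_labelled n \<A> l) (vertex_labelled n \<A> k) p \<and>
                 (\<forall>v\<in>set p. Q (vertex_label n \<A> v)) \<and> d = length p - 1)"

definition weight :: "nat \<Rightarrow> orientation \<Rightarrow> nat set set \<Rightarrow> nat \<Rightarrow> nat" where
  "weight n \<A> T l =
     (let labels = vertex_label n \<A> ` middle_triangle n \<A> T l; k = Min labels; m = Max labels
      in boundary_edges n \<A> l k (\<lambda>i. i \<le> l) * boundary_edges n \<A> l m (\<lambda>i. i \<ge> l))"

definition asso_coord :: "nat \<Rightarrow> orientation \<Rightarrow> nat set set \<Rightarrow> nat \<Rightarrow> real" where
  "asso_coord n \<A> T j =
     (if j \<in> down_elements n \<A> then real (weight n \<A> T j)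
      else real (n + 1) - real (weight n \<A> T j))"

text \<open>
  The coordinates of the space \<open>real ^ 'n\<close> of dimension \<open>n\<close> are numbered \<open>1, \<dots>, n\<close> by a bijection
  \<open>idx\<close> from the index type to \<open>{1..n}\<close>.
\<close>

definition asso_point ::
  "nat \<Rightarrow> ('n::finite \<Rightarrow> nat) \<Rightarrow> orientation \<Rightarrow> nat set set \<Rightarrow> real ^ 'n" where
  "asso_point n idx \<A> T = (\<chi> i. asso_coord n \<A> T (idx i))"

text \<open>
  The vertices of the associahedron (the convex hull of the points \<open>asso_point n idx \<A> T\<close>) are
  exactly these points, and distinct triangulations give distinct points. The isobarycenter of the
  vertices is therefore the isobarycenter of this family indexed by the triangulations.
\<close>

definition asso_center_of_gravity ::
  "nat \<Rightarrow> (nat \<Rightarrow> complex) \<Rightarrow> ('n::finite \<Rightarrow> nat) \<Rightarrow> orientation \<Rightarrow> real ^ 'n" where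
  "asso_center_of_gravity n A idx \<A> =
     (THE G. (\<Sum>T\<in>triangulations n A. asso_point n idx \<A> T - G) = 0)"

end

theory Submission
  imports Defs
begin

text \<open>
  Write \<open>N = n + 2\<close> and let \<open>r\<^sub>s\<close> be the reflection \<open>x \<mapsto> s - x\<close> of the vertices modulo \<open>N\<close>. It is
  induced by an isometry of the polygon, so it permutes the triangulations, and sums over all
  triangulations may be averaged over reflections.

  The labels below \<open>l\<close> and the labels above \<open>l\<close> occupy two arcs that start at the two neighbours of
  the vertex \<open>v\<close> labelled \<open>l\<close> and together exhaust the other vertices. Applying \<open>r\<^sub>v\<close> moves \<open>v\<close> to
  \<open>0\<close>; the arcs become \<open>{1..m}\<close> and \<open>{m + 1..n + 1}\<close>, with \<open>m = l\<close> if \<open>l\<close> is down and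
  \<open>m = n + 1 - l\<close> if \<open>l\<close> is up. The triangle with middle label \<open>l\<close> becomes the unique triangle
  \<open>{0, b, c}\<close> with \<open>b \<le> m < c\<close>, and its weight is \<open>b (N - c)\<close>, whatever the orientation
  (\<open>weight_eq_gap_weight\<close>). It therefore suffices that the mean of \<open>b (N - c)\<close> over all triangulations is
  \<open>(n + 1) / 2\<close> for every \<open>m\<close> (\<open>sum_gap_weight\<close>): this value is fixed by \<open>x \<mapsto> n + 1 - x\<close>, so the
  different definitions of the coordinate at down and at up elements agree on it.

  For \<open>m = 1\<close> the triangle is \<open>{0, 1, c}\<close> with weight \<open>N - c\<close>; the reflection \<open>r\<^sub>1\<close> turns this into
  \<open>c - 1\<close>, and the two add up to \<open>n + 1\<close>. When \<open>m - 1\<close> is increased to \<open>m\<close>, the triangle changes only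
  if the chord from \<open>0\<close> to \<open>m\<close> belongs to the triangulation. It then has one triangle \<open>{0, b, m}\<close> with
  \<open>b < m\<close> and one triangle \<open>{0, m, c}\<close> with \<open>m < c\<close>, and the weight grows by \<open>m (N - c) - b (N - m)\<close>.
  The reflection \<open>r\<^sub>m\<close> exchanges the ends of the chord and turns this growth into
  \<open>m (c - m) - (m - b) (N - m)\<close>; the two add up to \<open>m (N - m) - m (N - m) = 0\<close>.

  Existence and uniqueness of the triangles come from counting: triangles \<open>i < j < k\<close> and
  \<open>i' < j < k'\<close> with the same middle vertex cross unless they are equal
  (\<open>noncrossing_same_middle\<close>), so the \<open>n\<close> triangles of a triangulation have each of the \<open>n\<close> inner
  vertices \<open>1, \<dots>, n\<close> as a middle exactly once. A reflection moves the gap between \<open>m\<close> and \<open>m + 1\<close>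
  to the ends of the vertex sequence. The fan at the vertex \<open>0\<close> shows that there is at least one
  triangulation, so that the isobarycenter is unique.
\<close>

section \<open>Chords of a regular polygon\<close>

text \<open>
  Twice the signed area of the triangle \<open>x y z\<close>, positive if it is oriented counterclockwise.
\<close>

definition orient :: "complex \<Rightarrow> complex \<Rightarrow> complex \<Rightarrow> real" where
  "orient x y z = Im (cnj (y - x) * (z - x))"

lemma orient_refl [simp]: "orient x y x = 0" "orient x y y = 0"
  by (simp_all add: orient_def algebra_simps)

lemma orient_rotate: "orient y z x = orient x y z"
  by (simp add: orient_def algebra_simps)

lemma orient_affine:
  "orient x y ((1 - t) *\<^sub>R u + t *\<^sub>R v) = (1 - t) * orient x y u + t * orient x y v"
  by (simp add: orient_def algebra_simps)

text \<open>
  The diagonals of a convex quadrilateral \<open>a c b d\<close> meet: the affine dependence of its four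
  vertices, whose coefficients are the signed areas, writes one point as a convex combination of
  \<open>a\<close>, \<open>b\<close> and of \<open>c\<close>, \<open>d\<close>.
\<close>

lemma open_segments_meet:
  assumes "orient a c b > 0" "orient a c d > 0" "orient a b d > 0" "orient c b d > 0"
  shows "open_segment a b \<inter> open_segment c d \<noteq> {}"
proof -
  \<comment> \<open>\<open>s\<close> is twice the area of the quadrilateral, which either diagonal cuts into two triangles.\<close>
  define s where "s = orient c b d + orient a c d"
  have s: "s > 0" "s = orient a b d + orient a c b"
    using assms by (auto simp: s_def orient_def algebra_simps)
  define p where "p = (1 - orient a c d / s) *\<^sub>R a + (orient a c d / s) *\<^sub>R b"
  have p: "p = (1 - orient a c b / s) *\<^sub>R c + (orient a c b / s) *\<^sub>R d"
  proof -
    have "(s - orient a c d) *\<^sub>R a + orient a c d *\<^sub>R b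
        = (s - orient a c b) *\<^sub>R c + orient a c b *\<^sub>R d"
      unfolding s_def by (simp add: complex_eq_iff orient_def algebra_simps)
    moreover have "s *\<^sub>R p = (s - orient a c d) *\<^sub>R a + orient a c d *\<^sub>R b"
      using s(1) by (simp add: p_def scaleR_add_right right_diff_distrib)
    moreover have "s *\<^sub>R ((1 - orient a c b / s) *\<^sub>R c + (orient a c b / s) *\<^sub>R d)
        = (s - orient a c b) *\<^sub>R c + orient a c b *\<^sub>R d"
      using s(1) by (simp add: scaleR_add_right right_diff_distrib)
    ultimately have "s *\<^sub>R p = s *\<^sub>R ((1 - orient a c b / s) *\<^sub>R c + (orient a c b / s) *\<^sub>R d)"
      by simp
    then show ?thesis using s(1) by (simp only: scaleR_cancel_left) simp
  qed
  have ne: "a \<noteq> b" "c \<noteq> d" using assms by (auto simp: orient_def)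
  have "p \<in> open_segment a b"
    unfolding in_segment using ne s assms
    by (auto simp: p_def s_def intro!: exI[of _ "orient a c d / s"])
  moreover have "p \<in> open_segment c d"
    unfolding in_segment using ne s assms
    by (auto simp: p intro!: exI[of _ "orient a c b / s"])
  ultimately show ?thesis by blast
qed

text \<open>
  The signed area vanishes along the line through \<open>a\<close> and \<open>b\<close> and, being affine, is positive on the
  whole open segment from \<open>c\<close> to \<open>d\<close>.
\<close>

lemma open_segments_disjoint:
  assumes "orient a b c \<ge> 0" "orient a b d \<ge> 0" "orient a b c > 0 \<or> orient a b d > 0"
  shows "open_segment a b \<inter> open_segment c d = {}"
proof (rule ccontr)
  assume "\<not> ?thesis"
  then obtain p where p: "p \<in> open_segment a b" "p \<in> open_segment c d" by blast
  from p(1) have "orient a b p = 0" by (auto simp: in_segment orient_affine)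
  moreover from p(2) obtain t where t: "0 < t" "t < 1" "p = (1 - t) *\<^sub>R c + t *\<^sub>R d"
    by (auto simp: in_segment)
  then have "orient a b p = (1 - t) * orient a b c + t * orient a b d"
    by (simp add: orient_affine)
  moreover have "\<dots> > 0"
    using assms t by (auto intro: add_pos_nonneg add_nonneg_pos)
  ultimately show False by simp
qed

lemma four_sin_product:
  fixes x y :: real
  shows "sin (2 * x) + sin (2 * y) - sin (2 * (x + y)) = 4 * sin x * sin y * sin (x + y)"
proof -
  have "sin (2 * x) * (1 - cos (2 * y)) + sin (2 * y) * (1 - cos (2 * x))
      = 4 * sin x * sin y * sin (x + y)"
    by (simp add: cos_double_sin sin_double) (simp add: sin_add power2_eq_square algebra_simps)
  moreover have "sin (2 * (x + y)) = sin (2 * x) * cos (2 * y) + cos (2 * x) * sin (2 * y)"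
    by (simp add: distrib_left sin_add)
  ultimately show ?thesis by (simp add: algebra_simps)
qed

text \<open>
  The product form makes the sign of the area of an inscribed triangle visible from its half-angles.
\<close>

lemma orient_cis:
  "orient (cis a) (cis (a + 2 * x)) (cis (a + 2 * x + 2 * y)) = 4 * sin x * sin y * sin (x + y)"
proof -
  have "orient (cis a) (cis b) (cis e) = sin (b - a) + sin (e - b) - sin (e - a)" for b e
    by (simp add: orient_def sin_diff algebra_simps)
  note this[of "a + 2 * x" "a + 2 * x + 2 * y"]
  moreover have "a + 2 * x + 2 * y - a = 2 * (x + y)" by simp
  ultimately show ?thesis using four_sin_product[of x y] by simp
qed

lemma orient_scale_translate:
  "orient (c + of_real r * x) (c + of_real r * y) (c + of_real r * z) = r\<^sup>2 * orient x y z"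
  by (simp add: orient_def algebra_simps power2_eq_square)

lemma regular_polygon_orient_pos:
  assumes "regular_polygon N A" "i < j" "j < k" "k < N"
  shows "orient (A i) (A j) (A k) > 0"
proof -
  obtain c r \<theta> where r: "r > 0"
    and A: "\<And>j. j < N \<Longrightarrow> A j = c + of_real r * cis (\<theta> + 2 * pi * real j / real N)"
    using assms(1) unfolding regular_polygon_def by blast
  define x where "x = pi * (real j - real i) / real N"
  define y where "y = pi * (real k - real j) / real N"
  have N: "real N > 0" using assms by simp
  have sum: "x + y = pi * (real k - real i) / real N"
    by (simp add: x_def y_def add_divide_distrib [symmetric] algebra_simps)
  have pos: "sin (pi * (real q - real p) / real N) > 0" if "p < q" "q < N" for p q
  proof (rule sin_gt_zero)
    show "0 < pi * (real q - real p) / real N" using that N by simp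
    have "(real q - real p) / real N < 1" using that N by simp
    then show "pi * (real q - real p) / real N < pi"
      using mult_strict_left_mono[of "(real q - real p) / real N" 1 pi] by simp
  qed
  have "A i = c + of_real r * cis (\<theta> + 2 * pi * real i / real N)"
    using A assms by simp
  moreover have "\<theta> + 2 * pi * real j / real N = \<theta> + 2 * pi * real i / real N + 2 * x"
    using N by (simp add: x_def field_simps)
  then have "A j = c + of_real r * cis (\<theta> + 2 * pi * real i / real N + 2 * x)"
    using A[of j] assms by (simp only:)
  moreover have "\<theta> + 2 * pi * real k / real N = \<theta> + 2 * pi * real i / real N + 2 * x + 2 * y"
    using N by (simp add: x_def y_def field_simps)
  then have "A k = c + of_real r * cis (\<theta> + 2 * pi * real i / real N + 2 * x + 2 * y)"
    using A[of k] assms by (simp only:)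
  ultimately have "orient (A i) (A j) (A k) = r\<^sup>2 * (4 * sin x * sin y * sin (x + y))"
    by (simp only: orient_scale_translate orient_cis)
  then show ?thesis
    using pos[of i j] pos[of j k] pos[of i k] assms r sum by (simp add: x_def y_def)
qed

lemma regular_polygon_chords_cross:
  assumes "regular_polygon N A" "a < c" "c < b" "b < d" "d < N"
  shows "open_segment (A a) (A b) \<inter> open_segment (A c) (A d) \<noteq> {}"
  using assms by (intro open_segments_meet regular_polygon_orient_pos[OF assms(1)]) auto

text \<open>
  Up to a cyclic rotation, which preserves the signed area, the three vertices are in increasing order.
\<close>

lemma regular_polygon_orient_outside:
  assumes "regular_polygon N A" "a < b" "b < N" "x < N" "x \<le> a \<or> b \<le> x"
  shows "orient (A a) (A b) (A x) \<ge> 0" "x \<notin> {a, b} \<Longrightarrow> orient (A a) (A b) (A x) > 0"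
proof -
  show pos: "orient (A a) (A b) (A x) > 0" if "x \<notin> {a, b}"
  proof (cases "x < a")
    case True
    then show ?thesis
      using regular_polygon_orient_pos[OF assms(1) True assms(2,3)] by (simp add: orient_rotate)
  next
    case False
    then show ?thesis
      using that assms regular_polygon_orient_pos[OF assms(1), of a b x] by auto
  qed
  show "orient (A a) (A b) (A x) \<ge> 0"
    using pos by (cases "x \<in> {a, b}") (auto simp: less_imp_le)
qed

lemma regular_polygon_chords_disjoint:
  assumes A: "regular_polygon N A" and "a < b" "b < N" "c < N" "d < N" "{a, b} \<noteq> {c, d}"
    "c \<noteq> d" "c \<le> a \<or> b \<le> c" "d \<le> a \<or> b \<le> d"
  shows "open_segment (A a) (A b) \<inter> open_segment (A c) (A d) = {}"
proof -
  have "c \<notin> {a, b} \<or> d \<notin> {a, b}" using assms by auto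
  then show ?thesis
    using assms by (intro open_segments_disjoint) (auto intro: regular_polygon_orient_outside[OF A])
qed

section \<open>The fan triangulation\<close>

definition fan :: "nat \<Rightarrow> nat set set" where
  "fan n = (\<lambda>i. {0, i, Suc i}) ` {1..n}"

text \<open>
  A side of the fan is a chord at \<open>0\<close> or an edge of the polygon. An edge leaves
  every other side on its left; of two chords at \<open>0\<close>, the one with the smaller second endpoint leaves
  the other on its left.
\<close>

lemma fan_noncrossing:
  assumes A: "regular_polygon (n + 2) A" and s: "s \<in> fan n" and t: "t \<in> fan n"
  shows "noncrossing_sides A s t"
proof -
  have side: "a < n + 2 \<and> b < n + 2 \<and> (a = 0 \<or> b = Suc a)"
    if "u \<in> fan n" "a \<in> u" "b \<in> u" "a < b" for u a b
    using that by (auto simp: fan_def)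
  have *: "open_segment (A a) (A b) \<inter> open_segment (A c) (A d) = {}"
    if "u \<in> fan n" "w \<in> fan n" "a \<in> u" "b \<in> u" "c \<in> w" "d \<in> w" "a < b" "c < d"
      "{a, b} \<noteq> {c, d}" for u w a b c d
  proof -
    have ab: "a < n + 2" "b < n + 2" "a = 0 \<or> b = Suc a" using side that by blast+
    have cd: "c < n + 2" "d < n + 2" "c = 0 \<or> d = Suc c" using side that by blast+
    have ne: "b \<noteq> d \<or> a \<noteq> c" using that by auto
    consider "b = Suc a" | "d = Suc c" | "a = 0" "c = 0" "b < d" | "a = 0" "c = 0" "d < b"
      using ab cd ne by linarith
    then show ?thesis
    proof cases
      case 1
      then show ?thesis
        using that ab cd by (intro regular_polygon_chords_disjoint[OF A]) auto
    next
      case 2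
      then have "open_segment (A c) (A d) \<inter> open_segment (A a) (A b) = {}"
        using that ab cd by (intro regular_polygon_chords_disjoint[OF A]) auto
      then show ?thesis by blast
    next
      case 3
      then show ?thesis
        using that ab cd by (intro regular_polygon_chords_disjoint[OF A]) auto
    next
      case 4
      then have "open_segment (A c) (A d) \<inter> open_segment (A a) (A b) = {}"
        using that ab cd by (intro regular_polygon_chords_disjoint[OF A]) auto
      then show ?thesis by blast
    qed
  qed
  show ?thesis
    unfolding noncrossing_sides_def
  proof (intro ballI impI)
    fix a b c d
    assume h: "a \<in> s" "b \<in> s" "c \<in> t" "d \<in> t" "{a, b} \<noteq> {c, d}"
    consider "a = b" | "c = d" | "a < b" "c < d" | "a < b" "d < c" | "b < a" "c < d" | "b < a" "d < c"
      by linarith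
    then show "open_segment (A a) (A b) \<inter> open_segment (A c) (A d) = {}"
    proof cases
      case 3 then show ?thesis using *[OF s t, of a b c d] h by auto
    next
      case 4 then show ?thesis using *[OF s t, of a b d c] h
        by (auto simp: insert_commute open_segment_commute)
    next
      case 5 then show ?thesis using *[OF s t, of b a c d] h
        by (auto simp: insert_commute open_segment_commute)
    next
      case 6 then show ?thesis using *[OF s t, of b a d c] h
        by (auto simp: insert_commute open_segment_commute)
    qed simp_all
  qed
qed

lemma fan_in_triangulations:
  assumes "regular_polygon (n + 2) A"
  shows "fan n \<in> triangulations n A"
proof -
  have "inj_on (\<lambda>i. {0, i, Suc i}) {1..n}"
  proof (rule inj_onI)
    fix i j :: nat
    assume "{0, i, Suc i} = {0, j, Suc j}"
    then have "Max {0, i, Suc i} = Max {0, j, Suc j}" by (rule arg_cong)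
    then show "i = j" by simp
  qed
  then have "card (fan n) = n" by (simp add: fan_def card_image)
  then show ?thesis
    using fan_noncrossing[OF assms]
    by (auto simp: triangulations_def polygon_triangles_def fan_def)
qed

lemma finite_triangulations [simp]: "finite (triangulations n A)"
proof (rule finite_subset)
  show "triangulations n A \<subseteq> Pow (Pow {..<n + 2})"
    by (auto simp: triangulations_def polygon_triangles_def)
qed simp

section \<open>Reflections of triangulations\<close>

text \<open>
  The map \<open>x \<mapsto> s - x\<close> modulo \<open>N\<close>, for \<open>x < N\<close>.
\<close>

definition reflect :: "nat \<Rightarrow> nat \<Rightarrow> nat \<Rightarrow> nat" where
  "reflect N s x = (if x \<le> s then s - x else s + N - x)"

lemma reflect_less: "s < N \<Longrightarrow> x < N \<Longrightarrow> reflect N s x < N"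
  by (auto simp: reflect_def)

lemma reflect_reflect [simp]: "s < N \<Longrightarrow> x < N \<Longrightarrow> reflect N s (reflect N s x) = x"
  by (auto simp: reflect_def)

lemma reflect_image_image [simp]:
  "s < N \<Longrightarrow> t \<subseteq> {..<N} \<Longrightarrow> reflect N s ` reflect N s ` t = t"
  by (force simp: image_image subset_iff cong: image_cong)

lemma inj_on_reflect: "s < N \<Longrightarrow> inj_on (reflect N s) {..<N}"
  by (metis inj_onI lessThan_iff reflect_reflect)

definition reflect_tri :: "nat \<Rightarrow> nat \<Rightarrow> nat set set \<Rightarrow> nat set set" where
  "reflect_tri N s T = (`) (reflect N s) ` T"

text \<open>
  The isometry is the complex conjugation followed by a rotation and a translation; only its
  compatibility with open segments matters, so noncrossing is transported without any case
  analysis on the position of the chords.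
\<close>

lemma regular_polygon_reflect:
  assumes "regular_polygon N A" "s < N"
  obtains f where "\<And>x. x < N \<Longrightarrow> A (reflect N s x) = f (A x)" "inj f"
    "\<And>x y. open_segment (f x) (f y) = f ` open_segment x y"
proof -
  obtain c r \<theta> where r: "r > 0"
    and A: "\<And>j. j < N \<Longrightarrow> A j = c + of_real r * cis (\<theta> + 2 * pi * real j / real N)"
    using assms(1) unfolding regular_polygon_def by blast
  \<comment> \<open>The reflection must send the angle of vertex \<open>0\<close> to that of vertex \<open>s\<close>, so the two add up to \<open>u\<close>.\<close>
  define u where "u = cis (2 * \<theta> + 2 * pi * real s / real N)"
  define g where "g = (\<lambda>z. u * cnj z)"
  define f where "f = (\<lambda>z. (c - u * cnj c) + g z)"
  have lin: "linear g"
    by (rule linearI) (simp_all add: g_def algebra_simps)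
  have inj: "inj g" by (rule injI) (simp add: g_def u_def)
  have "A (reflect N s x) = f (A x)" if x: "x < N" for x
  proof -
    have N: "real N > 0" using x by simp
    have "f (A x) = c + of_real r * (u * cis (- (\<theta> + 2 * pi * real x / real N)))"
      by (simp add: f_def g_def A x algebra_simps cis_cnj)
    also have "\<dots> = c + of_real r * cis (\<theta> + 2 * pi * (real s - real x) / real N)"
    proof -
      have "2 * \<theta> + 2 * pi * real s / real N - (\<theta> + 2 * pi * real x / real N)
          = \<theta> + 2 * pi * (real s - real x) / real N"
        by (simp add: right_diff_distrib diff_divide_distrib)
      then show ?thesis by (simp add: u_def cis_mult)
    qed
    also have "cis (\<theta> + 2 * pi * (real s - real x) / real N)
        = cis (\<theta> + 2 * pi * real (reflect N s x) / real N)"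
    proof (cases "x \<le> s")
      case True
      then show ?thesis by (simp add: reflect_def of_nat_diff)
    next
      case False
      then have "real (reflect N s x) = real s + real N - real x"
        using x by (simp add: reflect_def of_nat_diff)
      then have "\<theta> + 2 * pi * real (reflect N s x) / real N
          = (\<theta> + 2 * pi * (real s - real x) / real N) + 2 * pi"
        using N by (simp only: add.assoc add_left_cancel) (simp add: field_simps)
      then show ?thesis by (simp only: cis_mult [symmetric] cis_2pi mult_1_right)
    qed
    finally show ?thesis using A[of "reflect N s x"] reflect_less[OF assms(2) x] by simp
  qed
  moreover have "inj f" using inj by (auto simp: f_def inj_def)
  moreover have "open_segment (f x) (f y) = f ` open_segment x y" for x y
    by (simp only: f_def open_segment_translation open_segment_linear_image[OF lin inj] image_image)
  ultimately show ?thesis using that by blast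
qed

lemma reflect_noncrossing:
  assumes A: "regular_polygon N A" and s: "s < N" and t: "t \<subseteq> {..<N}" "u \<subseteq> {..<N}"
    and nc: "noncrossing_sides A t u"
  shows "noncrossing_sides A (reflect N s ` t) (reflect N s ` u)"
proof -
  obtain f where f: "\<And>x. x < N \<Longrightarrow> A (reflect N s x) = f (A x)" "inj f"
    "\<And>x y. open_segment (f x) (f y) = f ` open_segment x y"
    using regular_polygon_reflect[OF A s] by metis
  show ?thesis
    unfolding noncrossing_sides_def
  proof (clarsimp)
    fix a b c d
    assume h: "a \<in> t" "b \<in> t" "c \<in> u" "d \<in> u"
      "{reflect N s a, reflect N s b} \<noteq> {reflect N s c, reflect N s d}"
    have lt: "a < N" "b < N" "c < N" "d < N" using h t by auto
    have "{a, b} \<noteq> {c, d}" using h(5) by (auto simp: doubleton_eq_iff)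
    then have "open_segment (A a) (A b) \<inter> open_segment (A c) (A d) = {}"
      using nc h by (auto simp: noncrossing_sides_def)
    then show "open_segment (A (reflect N s a)) (A (reflect N s b)) \<inter>
               open_segment (A (reflect N s c)) (A (reflect N s d)) = {}"
      using lt f by (simp add: image_Int [symmetric])
  qed
qed

lemma triangulations_vertices:
  "T \<in> triangulations n A \<Longrightarrow> t \<in> T \<Longrightarrow> t \<subseteq> {..<n + 2}"
  by (auto simp: triangulations_def polygon_triangles_def)

lemma reflect_tri_in_triangulations:
  assumes A: "regular_polygon (n + 2) A" and s: "s < n + 2" and T: "T \<in> triangulations n A"
  shows "reflect_tri (n + 2) s T \<in> triangulations n A"
proof -
  let ?r = "reflect (n + 2) s"
  have "inj_on ((`) ?r) T"
    by (rule inj_on_inverseI[of _ "(`) ?r"]) (rule reflect_image_image[OF s triangulations_vertices[OF T]])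
  then have "card (reflect_tri (n + 2) s T) = n"
    using T by (simp add: reflect_tri_def card_image triangulations_def)
  moreover have "?r ` t \<in> polygon_triangles (n + 2)" if "t \<in> T" for t
  proof -
    have t: "t \<subseteq> {..<n + 2}" "card t = 3"
      using T that by (auto simp: triangulations_def polygon_triangles_def)
    have "card (?r ` t) = 3"
      using t inj_on_subset[OF inj_on_reflect[OF s]] by (simp add: card_image)
    then show ?thesis using t reflect_less[OF s] by (auto simp: polygon_triangles_def)
  qed
  moreover have "noncrossing_sides A (?r ` t) (?r ` u)" if "t \<in> T" "u \<in> T" for t u
  proof (rule reflect_noncrossing[OF A s])
    show "t \<subseteq> {..<n + 2}" "u \<subseteq> {..<n + 2}" using triangulations_vertices[OF T] that by blast+
    show "noncrossing_sides A t u" using T that by (simp add: triangulations_def)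
  qed
  ultimately show ?thesis by (auto simp: triangulations_def reflect_tri_def)
qed

lemma reflect_tri_reflect_tri:
  assumes "s < n + 2" "T \<in> triangulations n A"
  shows "reflect_tri (n + 2) s (reflect_tri (n + 2) s T) = T"
  using triangulations_vertices[OF assms(2)] assms(1)
  by (simp add: reflect_tri_def image_image[where f = "(`) _"] cong: image_cong)

lemma mem_reflect_tri:
  assumes "s < n + 2" "T \<in> triangulations n A" "t \<subseteq> {..<n + 2}"
  shows "t \<in> reflect_tri (n + 2) s T \<longleftrightarrow> reflect (n + 2) s ` t \<in> T"
proof
  assume "t \<in> reflect_tri (n + 2) s T"
  then obtain u where u: "u \<in> T" "t = reflect (n + 2) s ` u" by (auto simp: reflect_tri_def)
  then show "reflect (n + 2) s ` t \<in> T"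
    using reflect_image_image[OF assms(1) triangulations_vertices[OF assms(2)]] by simp
next
  assume "reflect (n + 2) s ` t \<in> T"
  then show "t \<in> reflect_tri (n + 2) s T"
    unfolding reflect_tri_def by (rule rev_image_eqI) (use assms in simp)
qed

lemma sum_reflect_tri:
  assumes "regular_polygon (n + 2) A" "s < n + 2"
  shows "(\<Sum>T\<in>triangulations n A. f (reflect_tri (n + 2) s T)) = (\<Sum>T\<in>triangulations n A. f T)"
  using assms
  by (intro sum.reindex_bij_witness[of _ "reflect_tri (n + 2) s" "reflect_tri (n + 2) s"])
     (simp_all only: reflect_tri_in_triangulations[OF assms] reflect_tri_reflect_tri[OF assms(2)])

section \<open>Triangles with a given middle vertex\<close>

text \<open>
  If \<open>i < i'\<close> then the sides \<open>i j\<close> and \<open>i' k'\<close> cross; if \<open>k < k'\<close> then the sides \<open>i k\<close> and \<open>j k'\<close>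
  cross.
\<close>

lemma noncrossing_same_middle:
  assumes A: "regular_polygon N A" and "i < j" "j < k" "i' < j" "j < k'" "k < N" "k' < N"
    and nc: "noncrossing_sides A {i, j, k} {i', j, k'}"
  shows "i' \<le> i" "k' \<le> k"
proof -
  show "i' \<le> i"
  proof (rule ccontr)
    assume "\<not> ?thesis"
    then have "open_segment (A i) (A j) \<inter> open_segment (A i') (A k') \<noteq> {}"
      using assms by (intro regular_polygon_chords_cross[OF A]) auto
    moreover have "{i, j} \<noteq> {i', k'}" using assms by auto
    ultimately show False using nc unfolding noncrossing_sides_def by blast
  qed
  show "k' \<le> k"
  proof (rule ccontr)
    assume "\<not> ?thesis"
    then have "open_segment (A i) (A k) \<inter> open_segment (A j) (A k') \<noteq> {}"
      using assms by (intro regular_polygon_chords_cross[OF A]) auto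
    moreover have "{i, k} \<noteq> {j, k'}" using assms by auto
    ultimately show False using nc unfolding noncrossing_sides_def by blast
  qed
qed

lemma triangle_with_middle_unique:
  assumes A: "regular_polygon (n + 2) A" and T: "T \<in> triangulations n A"
    and "i < j" "j < k" "i' < j" "j < k'" and s: "{i, j, k} \<in> T" and t: "{i', j, k'} \<in> T"
  shows "i = i'" "k = k'"
proof -
  have "k < n + 2" "k' < n + 2" using triangulations_vertices[OF T] s t by blast+
  moreover have "noncrossing_sides A {i, j, k} {i', j, k'}" "noncrossing_sides A {i', j, k'} {i, j, k}"
    using T s t by (auto simp: triangulations_def)
  ultimately show "i = i'" "k = k'"
    using noncrossing_same_middle[OF A, of i j k i' k'] noncrossing_same_middle[OF A, of i' j k' i k]
      assms(3-6) by simp_all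
qed

lemma card_3_ordered:
  fixes t :: "nat set"
  assumes "card t = 3"
  obtains i j k where "i < j" "j < k" "t = {i, j, k}"
proof -
  obtain a b c where t: "t = {a, b, c}" "a \<noteq> b" "b \<noteq> c" "a \<noteq> c"
    using assms by (auto simp: card_3_iff)
  consider "a < b" "b < c" | "a < c" "c < b" | "b < a" "a < c" | "b < c" "c < a"
    | "c < a" "a < b" | "c < b" "b < a" using t by linarith
  then show ?thesis using that t(1) by cases (metis insert_commute)+
qed

text \<open>
  The middle vertex is an injective function on the \<open>n\<close> triangles with values in the \<open>n\<close>-element set
  \<open>{1..n}\<close>, hence onto.
\<close>

lemma triangle_with_middle_exists:
  assumes A: "regular_polygon (n + 2) A" and T: "T \<in> triangulations n A" and j: "j \<in> {1..n}"
  obtains i k where "i < j" "j < k" "{i, j, k} \<in> T"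
proof -
  have card: "card T = n" using T by (simp add: triangulations_def)
  have "\<exists>j i k. i < j \<and> j < k \<and> t = {i, j, k}" if "t \<in> T" for t
  proof -
    have "card t = 3" using T that by (auto simp: triangulations_def polygon_triangles_def)
    then show ?thesis by (metis card_3_ordered)
  qed
  then obtain mid where mid: "\<And>t. t \<in> T \<Longrightarrow> \<exists>i k. i < mid t \<and> mid t < k \<and> t = {i, mid t, k}"
    by metis
  have "mid ` T \<subseteq> {1..n}"
  proof
    fix x assume "x \<in> mid ` T"
    then obtain t i k where "t \<in> T" "i < x" "x < k" "t = {i, x, k}" using mid by blast
    then show "x \<in> {1..n}" using triangulations_vertices[OF T, of t] by auto
  qed
  moreover have "inj_on mid T"
  proof (rule inj_onI)
    fix t u assume tu: "t \<in> T" "u \<in> T" "mid t = mid u"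
    obtain i k i' k' where "i < mid t" "mid t < k" "t = {i, mid t, k}"
      "i' < mid t" "mid t < k'" "u = {i', mid t, k'}"
      using mid tu by metis
    then show "t = u" using triangle_with_middle_unique[OF A T, of i "mid t" k i' k'] tu by metis
  qed
  then have "card (mid ` T) = card {1..n}" by (simp add: card_image card)
  ultimately have "mid ` T = {1..n}" by (simp add: card_subset_eq)
  then show ?thesis using j mid that by (metis imageE)
qed

lemma reflect_tri_triangle:
  assumes "s < n + 2" "T \<in> triangulations n A" "x < n + 2" "y < n + 2" "z < n + 2"
  shows "{x, y, z} \<in> reflect_tri (n + 2) s T \<longleftrightarrow>
    {reflect (n + 2) s x, reflect (n + 2) s y, reflect (n + 2) s z} \<in> T"
  using mem_reflect_tri[OF assms(1,2), of "{x, y, z}"] assms(3-5) by simp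

text \<open>
  In the reflected triangulation \<open>m\<close> plays the role of \<open>0\<close>, and the triangles that straddle the gap
  between \<open>m\<close> and \<open>m + 1\<close> are those with middle vertex \<open>m\<close>.
\<close>

lemma gap_triangle_exists:
  assumes A: "regular_polygon (n + 2) A" and T: "T \<in> triangulations n A" and m: "m \<in> {1..n}"
  obtains b c where "b \<in> {1..m}" "c \<in> {m + 1..n + 1}" "{0, b, c} \<in> T"
proof -
  let ?r = "reflect (n + 2) m"
  have s: "m < n + 2" using m by simp
  have T': "reflect_tri (n + 2) m T \<in> triangulations n A"
    by (rule reflect_tri_in_triangulations[OF A s T])
  obtain i k where ik: "i < m" "m < k" "{i, m, k} \<in> reflect_tri (n + 2) m T"
    using triangle_with_middle_exists[OF A T' m] by metis
  then have k: "k < n + 2" using triangulations_vertices[OF T'] by blast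
  have "{?r i, ?r m, ?r k} \<in> T"
    using reflect_tri_triangle[OF s T, of i m k] ik k s by simp
  moreover have "?r i = m - i" "?r m = 0" "?r k = m + (n + 2) - k"
    using ik by (auto simp: reflect_def)
  ultimately have "{0, m - i, m + (n + 2) - k} \<in> T" by (simp add: insert_commute)
  moreover have "m - i \<in> {1..m}" "m + (n + 2) - k \<in> {m + 1..n + 1}" using ik k by auto
  ultimately show ?thesis using that by blast
qed

lemma gap_triangle_unique:
  assumes A: "regular_polygon (n + 2) A" and T: "T \<in> triangulations n A" and m: "m \<in> {1..n}"
    and bc: "b \<in> {1..m}" "c \<in> {m + 1..n + 1}" "{0, b, c} \<in> T"
    and bc': "b' \<in> {1..m}" "c' \<in> {m + 1..n + 1}" "{0, b', c'} \<in> T"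
  shows "b' = b" "c' = c"
proof -
  let ?r = "reflect (n + 2) m"
  have s: "m < n + 2" using m by simp
  have T': "reflect_tri (n + 2) m T \<in> triangulations n A"
    by (rule reflect_tri_in_triangulations[OF A s T])
  have *: "{m - x, m, m + (n + 2) - y} \<in> reflect_tri (n + 2) m T"
    if "x \<in> {1..m}" "y \<in> {m + 1..n + 1}" "{0, x, y} \<in> T" for x y
  proof -
    have "?r (m - x) = x" "?r m = 0" "?r (m + (n + 2) - y) = y"
      using that by (auto simp: reflect_def)
    then show ?thesis
      using reflect_tri_triangle[OF s T, of "m - x" m "m + (n + 2) - y"] that s
      by (auto simp: insert_commute)
  qed
  have "m - b = m - b'" "m + (n + 2) - c = m + (n + 2) - c'"
    using triangle_with_middle_unique[OF A T' _ _ _ _ *[OF bc] *[OF bc']] bc bc' by auto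
  then show "b' = b" "c' = c" using bc bc' by auto
qed

section \<open>The mean weight of a vertex\<close>

text \<open>
  For a triangulation \<open>T\<close> and \<open>1 \<le> m \<le> n\<close> exactly one term counts, so this is the value of \<open>f\<close> at the triangle at \<open>0\<close>
  that straddles the gap between \<open>m\<close> and \<open>m + 1\<close>. Written as a sum, its dependence on \<open>m\<close> is
  a rearrangement of sums, without distinguishing which chords are present.
\<close>

definition gap_sum :: "nat \<Rightarrow> nat \<Rightarrow> (nat \<Rightarrow> nat \<Rightarrow> real) \<Rightarrow> nat set set \<Rightarrow> real" where
  "gap_sum n m f T = (\<Sum>b\<in>{1..m}. \<Sum>c\<in>{m + 1..n + 1}. if {0, b, c} \<in> T then f b c else 0)"

lemma gap_sum_eq:
  assumes A: "regular_polygon (n + 2) A" and T: "T \<in> triangulations n A" and m: "m \<in> {1..n}"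
    and bc: "b \<in> {1..m}" "c \<in> {m + 1..n + 1}" "{0, b, c} \<in> T"
  shows "gap_sum n m f T = f b c"
proof -
  have "gap_sum n m f T =
    (\<Sum>b'\<in>{1..m}. if b' = b then \<Sum>c'\<in>{m + 1..n + 1}. if c' = c then f b c else 0 else 0)"
    unfolding gap_sum_def
  proof (rule sum.cong [OF refl])
    fix b' assume b': "b' \<in> {1..m}"
    have "(if {0, b', c'} \<in> T then f b' c' else 0) = (if b' = b then if c' = c then f b c else 0 else 0)"
      if "c' \<in> {m + 1..n + 1}" for c'
    proof (cases "{0, b', c'} \<in> T")
      case True
      then show ?thesis using gap_triangle_unique[OF A T m bc b' that] by simp
    next
      case False
      then have "\<not> (b' = b \<and> c' = c)" using bc(3) by blast
      then show ?thesis using False by simp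
    qed
    then have "(\<Sum>c'\<in>{m + 1..n + 1}. if {0, b', c'} \<in> T then f b' c' else 0) =
      (\<Sum>c'\<in>{m + 1..n + 1}. if b' = b then if c' = c then f b c else 0 else 0)"
      by (rule sum.cong [OF refl])
    also have "\<dots> = (if b' = b then \<Sum>c'\<in>{m + 1..n + 1}. if c' = c then f b c else 0 else 0)"
      by (cases "b' = b") (simp_all only: simp_thms if_True if_False sum.neutral_const)
    finally show "(\<Sum>c'\<in>{m + 1..n + 1}. if {0, b', c'} \<in> T then f b' c' else 0) =
      (if b' = b then \<Sum>c'\<in>{m + 1..n + 1}. if c' = c then f b c else 0 else 0)" .
  qed
  also have "\<dots> = f b c"
    using bc by (simp only: sum.delta finite_atLeastAtMost if_True)
  finally show ?thesis .
qed

lemma gap_sum_const: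
  assumes "regular_polygon (n + 2) A" "T \<in> triangulations n A" "m \<in> {1..n}"
  shows "gap_sum n m (\<lambda>b c. x) T = x"
  using gap_triangle_exists[OF assms] gap_sum_eq[OF assms] by metis

text \<open>
  The contributions of the triangles on the two sides of the chord from \<open>0\<close> to \<open>m\<close>: these are what
  the gap sum gains and loses when the gap moves past \<open>m\<close>.
\<close>

definition right_sum :: "nat \<Rightarrow> nat \<Rightarrow> (nat \<Rightarrow> real) \<Rightarrow> nat set set \<Rightarrow> real" where
  "right_sum n m f T = (\<Sum>c\<in>{m + 1..n + 1}. if {0, m, c} \<in> T then f c else 0)"

definition left_sum :: "nat \<Rightarrow> (nat \<Rightarrow> real) \<Rightarrow> nat set set \<Rightarrow> real" where
  "left_sum m f T = (\<Sum>b\<in>{1..<m}. if {0, b, m} \<in> T then f b else 0)"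

lemma gap_sum_Suc:
  assumes "Suc k \<le> n"
  shows "gap_sum n (Suc k) f T + left_sum (Suc k) (\<lambda>b. f b (Suc k)) T
       = gap_sum n k f T + right_sum n (Suc k) (f (Suc k)) T"
proof -
  have "{k + 1..n + 1} = insert (Suc k) {Suc k + 1..n + 1}" using assms by auto
  then have "gap_sum n k f T = left_sum (Suc k) (\<lambda>b. f b (Suc k)) T +
    (\<Sum>b\<in>{1..k}. \<Sum>c\<in>{Suc k + 1..n + 1}. if {0, b, c} \<in> T then f b c else 0)"
    by (simp add: gap_sum_def left_sum_def sum.distrib atLeastLessThanSuc_atLeastAtMost)
  moreover have "gap_sum n (Suc k) f T = right_sum n (Suc k) (f (Suc k)) T +
    (\<Sum>b\<in>{1..k}. \<Sum>c\<in>{Suc k + 1..n + 1}. if {0, b, c} \<in> T then f b c else 0)"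
    by (simp add: gap_sum_def right_sum_def)
  ultimately show ?thesis by simp
qed

lemma right_sum_reflect:
  assumes "m \<le> n" "T \<in> triangulations n A"
  shows "right_sum n m f (reflect_tri (n + 2) m T) = right_sum n m (\<lambda>c. f (n + 2 + m - c)) T"
  unfolding right_sum_def
proof (rule sum.reindex_bij_witness[of _ "\<lambda>c. n + 2 + m - c" "\<lambda>c. n + 2 + m - c"])
  fix c assume c: "c \<in> {m + 1..n + 1}"
  have "{0, m, c} \<in> reflect_tri (n + 2) m T \<longleftrightarrow> {0, m, n + 2 + m - c} \<in> T"
    using reflect_tri_triangle[OF _ assms(2), of m 0 m c] assms(1) c
    by (simp add: reflect_def insert_commute add.commute)
  then show "(if {0, m, n + 2 + m - c} \<in> T then f (n + 2 + m - (n + 2 + m - c)) else 0)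
      = (if {0, m, c} \<in> reflect_tri (n + 2) m T then f c else 0)"
    using c by simp
qed auto

lemma left_sum_reflect:
  assumes "m \<le> n" "T \<in> triangulations n A"
  shows "left_sum m f (reflect_tri (n + 2) m T) = left_sum m (\<lambda>b. f (m - b)) T"
  unfolding left_sum_def
proof (rule sum.reindex_bij_witness[of _ "\<lambda>b. m - b" "\<lambda>b. m - b"])
  fix b assume b: "b \<in> {1..<m}"
  have "{0, b, m} \<in> reflect_tri (n + 2) m T \<longleftrightarrow> {0, m - b, m} \<in> T"
    using reflect_tri_triangle[OF _ assms(2), of m 0 b m] assms(1) b
    by (simp add: reflect_def insert_commute)
  then show "(if {0, m - b, m} \<in> T then f (m - (m - b)) else 0)
      = (if {0, b, m} \<in> reflect_tri (n + 2) m T then f b else 0)"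
    using b by simp
qed auto

lemma right_sum_linear:
  "right_sum n m f T + right_sum n m g T = right_sum n m (\<lambda>c. f c + g c) T"
  unfolding right_sum_def sum.distrib [symmetric] by (rule sum.cong) auto

lemma left_sum_linear:
  "left_sum m f T + left_sum m g T = left_sum m (\<lambda>c. f c + g c) T"
  unfolding left_sum_def sum.distrib [symmetric] by (rule sum.cong) auto

lemma right_sum_cong:
  "(\<And>c. c \<in> {m + 1..n + 1} \<Longrightarrow> f c = g c) \<Longrightarrow> right_sum n m f T = right_sum n m g T"
  unfolding right_sum_def by (rule sum.cong) auto

lemma left_sum_cong:
  "(\<And>b. b \<in> {1..<m} \<Longrightarrow> f b = g b) \<Longrightarrow> left_sum m f T = left_sum m g T"
  unfolding left_sum_def by (rule sum.cong) auto

text \<open>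
  Averaging over the reflection that exchanges \<open>0\<close> and \<open>m\<close> replaces \<open>f\<close> by \<open>x / 2\<close>.
\<close>

lemma sum_right_sum:
  assumes A: "regular_polygon (n + 2) A" and m: "m \<le> n"
    and f: "\<And>c. c \<in> {m + 1..n + 1} \<Longrightarrow> f c + f (n + 2 + m - c) = x"
  shows "2 * (\<Sum>T\<in>triangulations n A. right_sum n m f T)
       = (\<Sum>T\<in>triangulations n A. right_sum n m (\<lambda>_. x) T)"
proof -
  have "(\<Sum>T\<in>triangulations n A. right_sum n m f T)
      = (\<Sum>T\<in>triangulations n A. right_sum n m f (reflect_tri (n + 2) m T))"
    using m by (intro sum_reflect_tri[OF A, symmetric]) simp
  also have "\<dots> = (\<Sum>T\<in>triangulations n A. right_sum n m (\<lambda>c. f (n + 2 + m - c)) T)"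
    by (intro sum.cong refl right_sum_reflect m)
  finally have "2 * (\<Sum>T\<in>triangulations n A. right_sum n m f T)
      = (\<Sum>T\<in>triangulations n A. right_sum n m f T + right_sum n m (\<lambda>c. f (n + 2 + m - c)) T)"
    by (simp add: sum.distrib)
  also have "\<dots> = (\<Sum>T\<in>triangulations n A. right_sum n m (\<lambda>_. x) T)"
    unfolding right_sum_linear by (intro sum.cong refl right_sum_cong f)
  finally show ?thesis .
qed

lemma sum_left_sum:
  assumes A: "regular_polygon (n + 2) A" and m: "m \<le> n"
    and f: "\<And>b. b \<in> {1..<m} \<Longrightarrow> f b + f (m - b) = x"
  shows "2 * (\<Sum>T\<in>triangulations n A. left_sum m f T)
       = (\<Sum>T\<in>triangulations n A. left_sum m (\<lambda>_. x) T)"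
proof -
  have "(\<Sum>T\<in>triangulations n A. left_sum m f T)
      = (\<Sum>T\<in>triangulations n A. left_sum m f (reflect_tri (n + 2) m T))"
    using m by (intro sum_reflect_tri[OF A, symmetric]) simp
  also have "\<dots> = (\<Sum>T\<in>triangulations n A. left_sum m (\<lambda>b. f (m - b)) T)"
    by (intro sum.cong refl left_sum_reflect m)
  finally have "2 * (\<Sum>T\<in>triangulations n A. left_sum m f T)
      = (\<Sum>T\<in>triangulations n A. left_sum m f T + left_sum m (\<lambda>b. f (m - b)) T)"
    by (simp add: sum.distrib)
  also have "\<dots> = (\<Sum>T\<in>triangulations n A. left_sum m (\<lambda>_. x) T)"
    unfolding left_sum_linear by (intro sum.cong refl left_sum_cong f)
  finally show ?thesis .
qed

text \<open>
  A chord has a triangle on one side iff it has one on the other, because the number of triangles that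
  straddle a gap is one both before and after the gap moves past the end of the chord.
\<close>

lemma left_sum_eq_right_sum:
  assumes A: "regular_polygon (n + 2) A" and T: "T \<in> triangulations n A" and k: "k \<in> {1..<n}"
  shows "left_sum (Suc k) (\<lambda>_. x) T = right_sum n (Suc k) (\<lambda>_. x) T"
  using gap_sum_Suc[of k n "\<lambda>_ _. x" T] k
    gap_sum_const[OF A T, of k x] gap_sum_const[OF A T, of "Suc k" x] by simp

text \<open>
  The vertex \<open>0\<close> is \<open>b\<close> boundary edges away from \<open>b\<close> on one side and \<open>n + 2 - c\<close> away from \<open>c\<close> on the
  other.
\<close>

definition gap_weight :: "nat \<Rightarrow> nat \<Rightarrow> nat set set \<Rightarrow> real" where
  "gap_weight n m = gap_sum n m (\<lambda>b c. real b * real (n + 2 - c))"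

text \<open>
  The induction step compares the gain \<open>m (N - c)\<close> with the loss \<open>b (N - m)\<close>: both average to half
  of \<open>m (N - m)\<close> on the chord from \<open>0\<close> to \<open>m\<close>.
\<close>

lemma sum_gap_weight:
  assumes A: "regular_polygon (n + 2) A" and m: "m \<in> {1..n}"
  shows "(\<Sum>T\<in>triangulations n A. gap_weight n m T) = real (card (triangulations n A)) * (real n + 1) / 2"
proof -
  have "1 \<le> m" "m \<le> n" using m by auto
  then show ?thesis
  proof (induction m rule: dec_induct)
    case base
    have *: "gap_sum n 1 f T = right_sum n 1 (f 1) T" for f T
      by (simp add: gap_sum_def right_sum_def)
    have "2 * (\<Sum>T\<in>triangulations n A. gap_weight n 1 T)
        = (\<Sum>T\<in>triangulations n A. right_sum n 1 (\<lambda>_. real n + 1) T)"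
      unfolding gap_weight_def * using base
      by (intro sum_right_sum[OF A]) (auto simp: of_nat_diff)
    also have "\<dots> = (\<Sum>T\<in>triangulations n A. real n + 1)"
      using gap_sum_const[OF A, where m = 1 and x = "real n + 1"] base
      unfolding * by (intro sum.cong refl) simp
    finally show ?case by simp
  next
    case (step k)
    let ?S = "\<lambda>f. \<Sum>T\<in>triangulations n A. f T"
    let ?m = "Suc k"
    \<comment> \<open>\<open>?x\<close> is twice the mean of the gain and of the loss, by the reflection that exchanges \<open>0\<close> and \<open>?m\<close>.\<close>
    let ?x = "real ?m * real (n + 2 - ?m)"
    have "2 * ?S (right_sum n ?m (\<lambda>c. real ?m * real (n + 2 - c))) = ?S (right_sum n ?m (\<lambda>_. ?x))"
      using step.prems
      by (intro sum_right_sum[OF A]) (auto simp: of_nat_diff algebra_simps)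
    moreover have "2 * ?S (left_sum ?m (\<lambda>b. real b * real (n + 2 - ?m))) = ?S (left_sum ?m (\<lambda>_. ?x))"
      using step.prems
      by (intro sum_left_sum[OF A]) (auto simp: of_nat_diff algebra_simps)
    moreover have "?S (left_sum ?m (\<lambda>_. ?x)) = ?S (right_sum n ?m (\<lambda>_. ?x))"
      using step by (intro sum.cong refl left_sum_eq_right_sum[OF A]) auto
    moreover have "?S (gap_weight n ?m) + ?S (left_sum ?m (\<lambda>b. real b * real (n + 2 - ?m)))
        = ?S (gap_weight n k) + ?S (right_sum n ?m (\<lambda>c. real ?m * real (n + 2 - c)))"
      unfolding gap_weight_def sum.distrib [symmetric]
      using gap_sum_Suc[OF step.prems] by (intro sum.cong refl) 
    ultimately have "?S (gap_weight n ?m) = ?S (gap_weight n k)" by linarith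
    then show ?case using step by simp
  qed
qed

section \<open>Boundary paths\<close>

lemma add_mod_eq: "v < N \<Longrightarrow> i \<le> N \<Longrightarrow> (v + i) mod N = (if v + i < N then v + i else v + i - N)"
  for v i N :: nat
  by (simp add: le_mod_geq)

lemma reflect_add: "v < N \<Longrightarrow> 0 < i \<Longrightarrow> i \<le> N \<Longrightarrow> reflect N v (N - i) = (v + i) mod N"
  by (auto simp: reflect_def add_mod_eq)

lemma reflect_step: "v < N \<Longrightarrow> Suc i < N \<Longrightarrow> reflect N v i = (reflect N v (Suc i) + 1) mod N"
  by (subst add_mod_eq) (auto simp: reflect_def)

lemma reflect_0 [simp]: "reflect N v 0 = v"
  by (simp add: reflect_def)

lemma successively_plus_nth:
  assumes "successively (\<lambda>a b. b = (a + 1) mod N) p" "p \<noteq> []" "hd p < N" "i < length p"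
  shows "p ! i = (hd p + i) mod N"
  using assms(4)
proof (induction i)
  case 0
  then show ?case using assms by (simp add: hd_conv_nth)
next
  case (Suc i)
  then show ?case using successively_nth[OF assms(1)] by (simp add: mod_Suc_eq)
qed

lemma successively_minus_nth:
  assumes "successively (\<lambda>a b. a = (b + 1) mod N) p" "p \<noteq> []" "hd p < N" "i < length p"
  shows "hd p = (p ! i + i) mod N"
  using assms(4)
proof (induction i)
  case 0
  then show ?case using assms by (simp add: hd_conv_nth)
next
  case (Suc i)
  then have "hd p = (p ! i + i) mod N" by simp
  also have "p ! i = (p ! Suc i + 1) mod N" using successively_nth[OF assms(1) Suc.prems] .
  finally show ?case by (simp add: mod_add_left_eq)
qed

text \<open>
  In a clockwise path the condition \<open>a = (b + 1) mod N\<close> does not bound \<open>b\<close>. It bounds \<open>a\<close>, so only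
  the last vertex needs the assumption on the endpoint.
\<close>

lemma boundary_path_vertices:
  assumes "boundary_path N v w p" "v < N" "w < N"
  shows "set p \<subseteq> {..<N}"
proof
  fix x assume "x \<in> set p"
  then obtain i where i: "i < length p" "x = p ! i" by (auto simp: in_set_conv_nth)
  have p: "p \<noteq> []" "hd p = v" "last p = w" using assms by (auto simp: boundary_path_def)
  consider "successively (\<lambda>a b. b = (a + 1) mod N) p" | "successively (\<lambda>a b. a = (b + 1) mod N) p"
    using assms by (auto simp: boundary_path_def)
  then show "x \<in> {..<N}"
  proof cases
    case 1
    then show ?thesis using successively_plus_nth[OF 1 p(1) _ i(1)] i p assms by simp
  next
    case 2
    show ?thesis
    proof (cases "Suc i < length p")
      case True
      then have "x = (p ! Suc i + 1) mod N" using successively_nth[OF 2 True] i by simp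
      then show ?thesis using assms by simp
    next
      case False
      then have "i = length p - 1" using i by simp
      then show ?thesis using i p assms by (simp add: last_conv_nth)
    qed
  qed
qed

text \<open>
  In the coordinate \<open>y\<close> of the vertex \<open>reflect N v y\<close>, clockwise is the direction of increasing \<open>y\<close>. The two
  kinds of path are told apart by their first step, so one forbidden neighbour of \<open>v\<close> excludes one
  kind.
\<close>

lemma boundary_path_cases:
  assumes p: "boundary_path N v (reflect N v y) p" and v: "v < N" and y: "0 < y" "y < N"
  shows "length p - 1 = y \<and> reflect N v 1 \<in> set p
       \<or> length p - 1 = N - y \<and> reflect N v (N - 1) \<in> set p"
proof -
  have w: "reflect N v y < N" using reflect_less v y by simp
  have sub: "set p \<subseteq> {..<N}" by (rule boundary_path_vertices[OF p v w])
  have d: "p \<noteq> []" "hd p = v" "last p = reflect N v y" "distinct p"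
    using p by (auto simp: boundary_path_def)
  have len: "length p \<le> N"
    using card_mono[OF _ sub] distinct_card[OF d(4)] by simp
  have last: "p ! (length p - 1) = reflect N v y" using d by (simp add: last_conv_nth)
  have "reflect N v y \<noteq> v" using v y by (auto simp: reflect_def)
  then have len2: "length p \<ge> 2"
    using d by (cases p) (auto simp: Suc_le_eq)
  consider "successively (\<lambda>a b. b = (a + 1) mod N) p" | "successively (\<lambda>a b. a = (b + 1) mod N) p"
    using p by (auto simp: boundary_path_def)
  then show ?thesis
  proof cases
    case 1
    have nth: "p ! i = reflect N v (N - i)" if "i < length p" "0 < i" for i
      using successively_plus_nth[OF 1 d(1) _ that(1)] d v that len by (simp add: reflect_add)
    have "reflect N v y = reflect N v (N - (length p - 1))"
      using nth[of "length p - 1"] last len2 by simp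
    then have "y = N - (length p - 1)"
      by (rule inj_onD[OF inj_on_reflect[OF v]]) (use y len2 in auto)
    moreover have "reflect N v (N - 1) \<in> set p"
      using nth[of 1] len2 nth_mem[of 1 p] by simp
    ultimately show ?thesis using len y by simp
  next
    case 2
    have nth: "p ! i = reflect N v i" if "i < length p" for i
    proof -
      have "v = (p ! i + i) mod N" using successively_minus_nth[OF 2 d(1) _ that] d v by simp
      moreover have "p ! i < N" using sub nth_mem[OF that] by blast
      ultimately show ?thesis
        using that len add_mod_eq[of "p ! i" N i] v by (auto simp: reflect_def split: if_splits)
    qed
    have "reflect N v y = reflect N v (length p - 1)"
      using nth[of "length p - 1"] last len2 by simp
    then have "y = length p - 1"
      by (rule inj_onD[OF inj_on_reflect[OF v]]) (use y len len2 in auto)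
    moreover have "reflect N v 1 \<in> set p"
      using nth[of 1] len2 nth_mem[of 1 p] by simp
    ultimately show ?thesis by simp
  qed
qed

lemma clockwise_boundary_path:
  assumes "v < N" "y < N"
  shows "boundary_path N v (reflect N v y) (map (reflect N v) [0..<Suc y])"
proof -
  have "inj_on (reflect N v) {0..<Suc y}"
    using assms by (auto intro: inj_on_subset[OF inj_on_reflect])
  then have "distinct (map (reflect N v) [0..<Suc y])"
    by (simp only: distinct_map distinct_upt set_upt simp_thms)
  moreover have "hd (map (reflect N v) [0..<Suc y]) = v"
    by (simp only: hd_map upt_conv_Cons zero_less_Suc list.map list.sel reflect_0)
  moreover have "successively (\<lambda>a b. a = (b + 1) mod N) (map (reflect N v) [0..<Suc y])"
    using reflect_step assms by (auto simp del: upt_Suc simp: successively_conv_nth)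
  ultimately show ?thesis by (simp add: boundary_path_def)
qed

lemma counterclockwise_boundary_path:
  assumes "v < N" "0 < y" "y < N"
  shows "boundary_path N v (reflect N v y) (map (\<lambda>i. (v + i) mod N) [0..<Suc (N - y)])"
proof -
  let ?p = "map (\<lambda>i. (v + i) mod N) [0..<Suc (N - y)]"
  have "inj_on (\<lambda>i. (v + i) mod N) {0..<Suc (N - y)}"
    using assms by (auto intro!: inj_onI simp: add_mod_eq split: if_splits)
  then have "distinct ?p"
    by (simp only: distinct_map distinct_upt set_upt simp_thms)
  moreover have "hd ?p = v"
    using assms by (simp add: upt_conv_Cons del: upt_Suc)
  moreover have "successively (\<lambda>a b. b = (a + 1) mod N) ?p"
    by (auto simp del: upt_Suc simp: successively_conv_nth mod_Suc_eq)
  moreover have "last ?p = reflect N v y"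
    using reflect_add[of v N "N - y"] assms by simp
  ultimately show ?thesis by (simp add: boundary_path_def)
qed

lemma boundary_edges_clockwise:
  assumes v: "vertex_labelled n \<A> l = v" and w: "vertex_labelled n \<A> k = reflect (n + 2) v y"
    and lt: "v < n + 2" "0 < y" "y < n + 2"
    and Q: "\<And>i. i \<le> y \<Longrightarrow> Q (vertex_label n \<A> (reflect (n + 2) v i))"
    and notQ: "\<not> Q (vertex_label n \<A> (reflect (n + 2) v (n + 1)))"
  shows "boundary_edges n \<A> l k Q = y"
  unfolding boundary_edges_def v w
proof (rule the_equality)
  show "\<exists>p. boundary_path (n + 2) v (reflect (n + 2) v y) p \<and>
      (\<forall>v\<in>set p. Q (vertex_label n \<A> v)) \<and> y = length p - 1"
    using clockwise_boundary_path[OF lt(1,3)] Q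
    by (intro exI[of _ "map (reflect (n + 2) v) [0..<Suc y]"]) (auto simp del: upt_Suc)
next
  fix d assume "\<exists>p. boundary_path (n + 2) v (reflect (n + 2) v y) p \<and>
      (\<forall>v\<in>set p. Q (vertex_label n \<A> v)) \<and> d = length p - 1"
  then show "d = y" using boundary_path_cases[OF _ lt] notQ by fastforce
qed

lemma boundary_edges_counterclockwise:
  assumes v: "vertex_labelled n \<A> l = v" and w: "vertex_labelled n \<A> k = reflect (n + 2) v y"
    and lt: "v < n + 2" "0 < y" "y < n + 2"
    and Q: "Q (vertex_label n \<A> v)"
      "\<And>i. y \<le> i \<Longrightarrow> i < n + 2 \<Longrightarrow> Q (vertex_label n \<A> (reflect (n + 2) v i))"
    and notQ: "\<not> Q (vertex_label n \<A> (reflect (n + 2) v 1))"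
  shows "boundary_edges n \<A> l k Q = n + 2 - y"
  unfolding boundary_edges_def v w
proof (rule the_equality)
  have "Q (vertex_label n \<A> ((v + i) mod (n + 2)))" if "i \<le> n + 2 - y" for i
  proof (cases "i = 0")
    case True
    then show ?thesis using Q(1) lt by simp
  next
    case False
    then have "reflect (n + 2) v (n + 2 - i) = (v + i) mod (n + 2)"
      using that lt by (intro reflect_add) auto
    then show ?thesis using Q(2)[of "n + 2 - i"] that lt False by simp
  qed
  then show "\<exists>p. boundary_path (n + 2) v (reflect (n + 2) v y) p \<and>
      (\<forall>v\<in>set p. Q (vertex_label n \<A> v)) \<and> n + 2 - y = length p - 1"
    using counterclockwise_boundary_path[OF lt]
    by (intro exI[of _ "map (\<lambda>i. (v + i) mod (n + 2)) [0..<Suc (n + 2 - y)]"])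
       (auto simp del: upt_Suc)
next
  fix d assume "\<exists>p. boundary_path (n + 2) v (reflect (n + 2) v y) p \<and>
      (\<forall>v\<in>set p. Q (vertex_label n \<A> v)) \<and> d = length p - 1"
  then show "d = n + 2 - y" using boundary_path_cases[OF _ lt] notQ by fastforce
qed

section \<open>The arcs of smaller and of larger labels\<close>

lemma up_elements_subset: "up_elements n \<A> \<subseteq> {1..n}"
  by (auto simp: up_elements_def)

lemma finite_up_down [simp]: "finite (up_elements n \<A>)" "finite (down_elements n \<A>)"
  using finite_subset[OF up_elements_subset] by (auto simp: down_elements_def)

lemma card_down_up: "card (down_elements n \<A>) + card (up_elements n \<A>) = n"
proof -
  have "card (down_elements n \<A>) = n - card (up_elements n \<A>)"
    using up_elements_subset by (simp add: down_elements_def card_Diff_subset)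
  moreover have "card (up_elements n \<A>) \<le> n"
    using card_mono[OF _ up_elements_subset[of n \<A>]] by simp
  ultimately show ?thesis by simp
qed

lemma vertex_label_bij: "bij_betw (vertex_label n \<A>) {..<n + 2} {..<n + 2}"
proof -
  let ?xs = "[0] @ sorted_list_of_set (down_elements n \<A>) @ [n + 1]
        @ rev (sorted_list_of_set (up_elements n \<A>))"
  have "distinct ?xs"
    using up_elements_subset[of n \<A>] by (auto simp: down_elements_def)
  moreover have "length ?xs = n + 2" using card_down_up[of n \<A>] by simp
  moreover have "set ?xs = {..<n + 2}"
    using up_elements_subset[of n \<A>] by (auto simp: down_elements_def)
  ultimately have "bij_betw ((!) ?xs) {..<n + 2} {..<n + 2}"
    by (intro bij_betw_nth) (simp_all only:)
  then show ?thesis by (simp only: vertex_label_def [abs_def])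
qed

lemma vertex_label_inj:
  "x < n + 2 \<Longrightarrow> y < n + 2 \<Longrightarrow> vertex_label n \<A> x = vertex_label n \<A> y \<longleftrightarrow> x = y"
  using vertex_label_bij[of n \<A>] by (auto simp: bij_betw_def inj_on_def)

lemma vertex_labelled_label [simp]:
  "x < n + 2 \<Longrightarrow> vertex_labelled n \<A> (vertex_label n \<A> x) = x"
  unfolding vertex_labelled_def by (rule the_equality) (auto simp: vertex_label_inj)

lemma vertex_label_increasing:
  assumes "i < j" "j \<le> Suc (card (down_elements n \<A>))"
  shows "vertex_label n \<A> i < vertex_label n \<A> j"
proof -
  let ?ys = "[0] @ sorted_list_of_set (down_elements n \<A>) @ [n + 1]"
  have "sorted_wrt (<) ?ys"
    by (auto simp: sorted_wrt_append down_elements_def)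
  moreover have "vertex_label n \<A> k = ?ys ! k" if "k \<le> Suc (card (down_elements n \<A>))" for k
    using that nth_append[of ?ys "rev (sorted_list_of_set (up_elements n \<A>))" k]
    by (simp add: vertex_label_def)
  ultimately show ?thesis using assms sorted_wrt_nth_less[of "(<)" ?ys i j] by simp
qed

lemma vertex_label_decreasing:
  assumes "Suc (card (down_elements n \<A>)) \<le> i" "i < j" "j < n + 2"
  shows "vertex_label n \<A> j < vertex_label n \<A> i"
proof -
  let ?ys = "[0] @ sorted_list_of_set (down_elements n \<A>)"
  let ?zs = "[n + 1] @ rev (sorted_list_of_set (up_elements n \<A>))"
  let ?p = "Suc (card (down_elements n \<A>))"
  have "sorted_wrt (>) ?zs"
    using up_elements_subset[of n \<A>] by (force simp: sorted_wrt_append sorted_wrt_rev)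
  moreover have "vertex_label n \<A> k = ?zs ! (k - ?p)" if "?p \<le> k" for k
    using that nth_append[of ?ys ?zs k] by (simp add: vertex_label_def)
  moreover have "length ?zs = n + 2 - ?p" using card_down_up[of n \<A>] by simp
  ultimately show ?thesis using assms sorted_wrt_nth_less[of "(>)" ?zs "i - ?p" "j - ?p"] by simp
qed

lemma down_vertex_exists:
  assumes "l \<in> down_elements n \<A>"
  obtains v where "v < Suc (card (down_elements n \<A>))" "vertex_label n \<A> v = l"
proof -
  let ?s = "sorted_list_of_set (down_elements n \<A>)"
  obtain i where i: "i < length ?s" "?s ! i = l"
    using assms by (metis finite_up_down(2) in_set_conv_nth set_sorted_list_of_set)
  have "vertex_label n \<A> (Suc i) = l"
    using i by (simp add: vertex_label_def nth_append)
  then show ?thesis using that[of "Suc i"] i by simp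
qed

lemma up_vertex_exists:
  assumes "l \<in> up_elements n \<A>"
  obtains v where "Suc (card (down_elements n \<A>)) < v" "v < n + 2" "vertex_label n \<A> v = l"
proof -
  let ?s = "rev (sorted_list_of_set (up_elements n \<A>))"
  let ?d = "card (down_elements n \<A>)"
  obtain i where i: "i < length ?s" "?s ! i = l"
    using assms by (metis finite_up_down(1) in_set_conv_nth set_sorted_list_of_set set_rev)
  have "vertex_label n \<A> (Suc (Suc (?d + i))) = l"
    using i by (simp add: vertex_label_def nth_append)
  then show ?thesis using that[of "Suc (Suc (?d + i))"] i card_down_up[of n \<A>] by simp
qed

text \<open>
  The label of the vertex reached from \<open>v\<close> after \<open>y\<close> clockwise steps.
\<close>

definition arc_label :: "nat \<Rightarrow> orientation \<Rightarrow> nat \<Rightarrow> nat \<Rightarrow> nat" where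
  "arc_label n \<A> v y = vertex_label n \<A> (reflect (n + 2) v y)"

lemma arc_label_bij:
  assumes "v < n + 2"
  shows "bij_betw (arc_label n \<A> v) {..<n + 2} {..<n + 2}"
proof -
  have "bij_betw (reflect (n + 2) v) {..<n + 2} {..<n + 2}"
    by (rule bij_betw_byWitness[of _ "reflect (n + 2) v"]) (use assms reflect_less in auto)
  from bij_betw_trans[OF this vertex_label_bij] show ?thesis
    by (simp add: arc_label_def [abs_def] comp_def)
qed

lemma initial_segment:
  fixes P :: "nat \<Rightarrow> bool"
  assumes "\<And>y z. 1 \<le> z \<Longrightarrow> z \<le> y \<Longrightarrow> y < N \<Longrightarrow> P y \<Longrightarrow> P z" and y: "y \<in> {1..<N}"
  shows "P y \<longleftrightarrow> y \<le> card {z \<in> {1..<N}. P z}"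
proof
  assume "P y"
  then have "{1..y} \<subseteq> {z \<in> {1..<N}. P z}" using assms by auto
  then show "y \<le> card {z \<in> {1..<N}. P z}" using card_mono[of "{z \<in> {1..<N}. P z}" "{1..y}"] by simp
next
  assume y': "y \<le> card {z \<in> {1..<N}. P z}"
  show "P y"
  proof (rule ccontr)
    assume "\<not> P y"
    then have "z < y" if "z \<in> {1..<N}" "P z" for z
      using assms(1)[of y z] y that by (metis atLeastLessThan_iff not_le)
    then have "{z \<in> {1..<N}. P z} \<subseteq> {1..<y}" by auto
    from card_mono[OF _ this] have "card {z \<in> {1..<N}. P z} \<le> y - 1" by simp
    moreover have "1 \<le> y" using y by simp
    ultimately show False using y' by linarith
  qed
qed

lemma card_arc_label:
  assumes v: "v < n + 2" and l: "l = vertex_label n \<A> v" and S: "S \<subseteq> {..<n + 2} - {l}"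
  shows "card {y \<in> {1..<n + 2}. arc_label n \<A> v y \<in> S} = card S"
proof -
  let ?B = "{y \<in> {1..<n + 2}. arc_label n \<A> v y \<in> S}"
  note bij = arc_label_bij[OF v, of \<A>]
  have "arc_label n \<A> v ` ?B = S"
  proof
    show "S \<subseteq> arc_label n \<A> v ` ?B"
    proof
      fix x assume x: "x \<in> S"
      then have "x \<in> arc_label n \<A> v ` {..<n + 2}" using bij S by (auto simp: bij_betw_def)
      then obtain y where y: "y < n + 2" "x = arc_label n \<A> v y" by auto
      then have "y \<noteq> 0" using x S l by (auto simp: arc_label_def)
      then show "x \<in> arc_label n \<A> v ` ?B" using x y by auto
    qed
  qed auto
  moreover have "inj_on (arc_label n \<A> v) ?B"
    by (rule inj_on_subset[of _ "{..<n + 2}"]) (use bij in \<open>auto simp: bij_betw_def\<close>)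
  ultimately show ?thesis by (metis card_image)
qed

text \<open>
  Along \<open>y = 1, 2, \<dots>\<close> the vertices run clockwise from \<open>v\<close> through smaller down labels to \<open>0\<close> and on
  through increasing up labels, so those with labels below \<open>l\<close> come first; counting them gives the
  length of this initial segment. For an up element the same walk meets the larger labels first.
\<close>

lemma down_arc_label:
  assumes v: "v < Suc (card (down_elements n \<A>))" and l: "l = vertex_label n \<A> v"
    and y: "y \<in> {1..<n + 2}"
  shows "arc_label n \<A> v y < l \<longleftrightarrow> y \<le> l"
proof -
  let ?L = "vertex_label n \<A>"
  let ?p = "Suc (card (down_elements n \<A>))"
  have p: "?p < n + 2" using card_down_up[of n \<A>] by simp
  have vn: "v < n + 2" using v p by simp
  have "arc_label n \<A> v z < l"
    if z: "1 \<le> z" "z \<le> y" "y < n + 2" and yl: "arc_label n \<A> v y < l" for y z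
  proof (cases "z \<le> v")
    case True
    then show ?thesis
      using vertex_label_increasing[of "v - z" v] z v l by (simp add: arc_label_def reflect_def)
  next
    case False
    let ?x = "v + (n + 2) - y" and ?x' = "v + (n + 2) - z"
    have yl: "?L ?x < l" using yl z False by (simp add: arc_label_def reflect_def)
    \<comment> \<open>The labels between \<open>v\<close> and the vertex labelled \<open>n + 1\<close> exceed \<open>l\<close>, so \<open>?x\<close> lies beyond that vertex.\<close>
    have "?p < ?x"
    proof (rule ccontr)
      assume "\<not> ?p < ?x"
      then have "l < ?L ?x" unfolding l using z False by (intro vertex_label_increasing) auto
      then show False using yl by simp
    qed
    then have "?x = ?x' \<or> ?p \<le> ?x \<and> ?x < ?x' \<and> ?x' < n + 2" using z False by linarith
    then have "?x = ?x' \<or> ?L ?x' < ?L ?x" using vertex_label_decreasing by metis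
    then have "?L ?x' < l" using yl by auto
    then show ?thesis using z False by (simp add: arc_label_def reflect_def)
  qed
  from initial_segment[of "n + 2" "\<lambda>y. arc_label n \<A> v y < l", OF this y]
  have "arc_label n \<A> v y < l \<longleftrightarrow> y \<le> card {z \<in> {1..<n + 2}. arc_label n \<A> v z \<in> {..<l}}"
    by simp
  moreover have "l < n + 2" using vertex_label_bij[of n \<A>] vn l by (auto simp: bij_betw_def)
  then have "card {z \<in> {1..<n + 2}. arc_label n \<A> v z \<in> {..<l}} = l"
    by (subst card_arc_label[OF vn l]) auto
  ultimately show ?thesis by simp
qed

lemma up_arc_label:
  assumes v: "Suc (card (down_elements n \<A>)) < v" "v < n + 2" and l: "l = vertex_label n \<A> v"
    and y: "y \<in> {1..<n + 2}"
  shows "l < arc_label n \<A> v y \<longleftrightarrow> y \<le> n + 1 - l"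
proof -
  let ?L = "vertex_label n \<A>"
  let ?p = "Suc (card (down_elements n \<A>))"
  have "l < arc_label n \<A> v z"
    if z: "1 \<le> z" "z \<le> y" "y < n + 2" and yl: "l < arc_label n \<A> v y" for y z
  proof (cases "y \<le> v")
    case False
    then have "arc_label n \<A> v y < l"
      using vertex_label_decreasing[of n \<A> v "v + (n + 2) - y"] z v l
      by (simp add: arc_label_def reflect_def)
    then show ?thesis using yl by simp
  next
    case True
    then have yl: "l < ?L (v - y)" using yl by (simp add: arc_label_def reflect_def)
    have "l < ?L (v - z)"
    proof (cases "?p \<le> v - z")
      case True
      then show ?thesis unfolding l using z v by (intro vertex_label_decreasing) auto
    next
      case False
      have "v - y = v - z \<or> ?L (v - y) < ?L (v - z)"
        using vertex_label_increasing[of "v - y" "v - z"] z False by force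
      then show ?thesis using yl by auto
    qed
    then show ?thesis using z True by (simp add: arc_label_def reflect_def)
  qed
  from initial_segment[of "n + 2" "\<lambda>y. l < arc_label n \<A> v y", OF this y]
  have "l < arc_label n \<A> v y \<longleftrightarrow> y \<le> card {z \<in> {1..<n + 2}. l < arc_label n \<A> v z}" .
  moreover have "{z \<in> {1..<n + 2}. l < arc_label n \<A> v z}
      = {z \<in> {1..<n + 2}. arc_label n \<A> v z \<in> {l<..<n + 2}}"
    using arc_label_bij[OF v(2), of \<A>] by (auto simp: bij_betw_def)
  moreover have "card {z \<in> {1..<n + 2}. arc_label n \<A> v z \<in> {l<..<n + 2}} = n + 1 - l"
    by (subst card_arc_label[OF v(2) l]) auto
  ultimately show ?thesis by simp
qed

lemma arc_label_eq_iff: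
  "v < n + 2 \<Longrightarrow> y < n + 2 \<Longrightarrow> z < n + 2 \<Longrightarrow> arc_label n \<A> v y = arc_label n \<A> v z \<longleftrightarrow> y = z"
  using arc_label_bij[of v n \<A>] by (auto simp: bij_betw_def inj_on_def)

lemma arc_label_0 [simp]: "arc_label n \<A> v 0 = vertex_label n \<A> v"
  by (simp add: arc_label_def)

lemma arc_label_reflect:
  "v < n + 2 \<Longrightarrow> x < n + 2 \<Longrightarrow> arc_label n \<A> v (reflect (n + 2) v x) = vertex_label n \<A> x"
  by (simp add: arc_label_def)

section \<open>Weights in terms of gap triangles\<close>

text \<open>
  The two alternatives are the down and the up case. In either, a triangle has middle label \<open>l\<close> iff it
  contains \<open>v\<close> and one vertex on each of the two arcs.
\<close>

lemma middle_triangle_eq: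
  assumes A: "regular_polygon (n + 2) A" and T: "T \<in> triangulations n A"
    and v: "v < n + 2" and l: "l = vertex_label n \<A> v" and m: "m \<in> {1..n}"
    and arc: "(\<forall>y\<in>{1..<n + 2}. arc_label n \<A> v y < l \<longleftrightarrow> y \<le> m) \<or>
              (\<forall>y\<in>{1..<n + 2}. l < arc_label n \<A> v y \<longleftrightarrow> y \<le> m)"
    and bc: "b \<in> {1..m}" "c \<in> {m + 1..n + 1}" "{0, b, c} \<in> reflect_tri (n + 2) v T"
  shows "middle_triangle n \<A> T l = reflect (n + 2) v ` {0, b, c}"
  unfolding middle_triangle_def
proof (rule the_equality)
  let ?r = "reflect (n + 2) v" and ?g = "arc_label n \<A> v"
  have T': "reflect_tri (n + 2) v T \<in> triangulations n A"
    by (rule reflect_tri_in_triangulations[OF A v T])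
  have ne: "?g y \<noteq> l" if "y \<in> {1..<n + 2}" for y
    using arc_label_eq_iff[OF v, of y 0 \<A>] that l by simp
  have lt: "b \<in> {1..<n + 2}" "c \<in> {1..<n + 2}" "b \<le> m" "\<not> c \<le> m" using bc m by auto
  have mem: "?r ` {0, b, c} \<in> T"
    using mem_reflect_tri[OF v T, of "{0, b, c}"] bc lt by auto
  have "?g b < l \<and> l < ?g c \<or> ?g c < l \<and> l < ?g b"
    using arc lt ne by (meson linorder_neqE_nat)
  moreover have img: "vertex_label n \<A> ` ?r ` {0, b, c} = {?g b, l, ?g c}"
    by (auto simp: arc_label_def l)
  ultimately have "\<exists>k m. k < l \<and> l < m \<and> vertex_label n \<A> ` ?r ` {0, b, c} = {k, l, m}"
    by (metis insert_commute)
  with mem show "?r ` {0, b, c} \<in> T \<and>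
      (\<exists>k m. k < l \<and> l < m \<and> vertex_label n \<A> ` ?r ` {0, b, c} = {k, l, m})" by blast
  fix t assume "t \<in> T \<and> (\<exists>k m. k < l \<and> l < m \<and> vertex_label n \<A> ` t = {k, l, m})"
  then obtain k k' where t: "t \<in> T" "k < l" "l < k'" "vertex_label n \<A> ` t = {k, l, k'}" by blast
  have sub: "t \<subseteq> {..<n + 2}" by (rule triangulations_vertices[OF T t(1)])
  have "?g ` ?r ` t = vertex_label n \<A> ` t"
    unfolding image_image using sub arc_label_reflect[OF v] by (intro image_cong refl) blast
  then have img_t: "?g ` ?r ` t = {k, l, k'}" by (simp only: t(4))
  let ?u = "?r ` t"
  have u: "?u \<in> reflect_tri (n + 2) v T" using t(1) by (auto simp: reflect_tri_def)
  have subu: "?u \<subseteq> {..<n + 2}" by (rule triangulations_vertices[OF T' u])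
  obtain x y z where xyz: "x \<in> ?u" "?g x = k" "y \<in> ?u" "?g y = l" "z \<in> ?u" "?g z = k'"
    using img_t by (smt (verit) imageE insertCI)
  have y0: "y = 0" using arc_label_eq_iff[OF v, of y 0 \<A>] xyz subu l by auto
  have u_eq: "?u = {0, x, z}"
  proof
    show "{0, x, z} \<subseteq> ?u" using xyz y0 by auto
    show "?u \<subseteq> {0, x, z}"
    proof
      fix w assume w: "w \<in> ?u"
      then have "?g w \<in> {k, l, k'}" using img_t by blast
      then have "?g w = ?g x \<or> ?g w = ?g 0 \<or> ?g w = ?g z" using xyz y0 by auto
      then show "w \<in> {0, x, z}"
        using arc_label_eq_iff[OF v, of w] w subu xyz by (metis insertCI lessThan_iff subsetD y0)
    qed
  qed
  have "?g x \<noteq> ?g 0" "?g z \<noteq> ?g 0"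
    unfolding xyz(2,6) arc_label_0 l [symmetric] using t(2,3) by simp_all
  then have "x \<noteq> 0" "z \<noteq> 0" by metis+
  moreover have "x < n + 2" "z < n + 2" using xyz subu by blast+
  ultimately have xz: "x \<in> {1..<n + 2}" "z \<in> {1..<n + 2}" by simp_all
  then have "x \<le> m \<and> \<not> z \<le> m \<or> z \<le> m \<and> \<not> x \<le> m"
    using arc xyz t by (metis not_less_iff_gr_or_eq)
  then have "x = b \<and> z = c \<or> x = c \<and> z = b"
    using gap_triangle_unique[OF A T' m bc, of x z] gap_triangle_unique[OF A T' m bc, of z x] u xz
    unfolding u_eq by (auto simp: insert_commute)
  then have "?u = {0, b, c}" unfolding u_eq by auto
  then show "t = ?r ` {0, b, c}" using reflect_image_image[OF v sub] by simp
qed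

text \<open>
  Both boundary paths of the weight run along a single arc. The path in the opposite direction starts
  in the other arc and so violates the bound on the labels at its first step; hence the two path
  lengths are \<open>b\<close> and \<open>n + 2 - c\<close>, in one order or the other.
\<close>

lemma weight_eq_gap_weight:
  assumes A: "regular_polygon (n + 2) A" and T: "T \<in> triangulations n A"
    and v: "v < n + 2" and l: "l = vertex_label n \<A> v" and m: "m \<in> {1..n}"
    and arc: "(\<forall>y\<in>{1..<n + 2}. arc_label n \<A> v y < l \<longleftrightarrow> y \<le> m) \<or>
              (\<forall>y\<in>{1..<n + 2}. l < arc_label n \<A> v y \<longleftrightarrow> y \<le> m)"
  shows "real (weight n \<A> T l) = gap_weight n m (reflect_tri (n + 2) v T)"
proof -
  let ?g = "arc_label n \<A> v" and ?r = "reflect (n + 2) v"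
  have T': "reflect_tri (n + 2) v T \<in> triangulations n A"
    by (rule reflect_tri_in_triangulations[OF A v T])
  obtain b c where bc: "b \<in> {1..m}" "c \<in> {m + 1..n + 1}" "{0, b, c} \<in> reflect_tri (n + 2) v T"
    by (rule gap_triangle_exists[OF A T' m])
  have gw: "gap_weight n m (reflect_tri (n + 2) v T) = real b * real (n + 2 - c)"
    unfolding gap_weight_def by (rule gap_sum_eq[OF A T' m bc])
  have ne: "?g y \<noteq> l" if "y \<in> {1..<n + 2}" for y
    using arc_label_eq_iff[OF v, of y 0 \<A>] that l by simp
  have lt: "0 < b" "b < n + 2" "0 < c" "c < n + 2" "b \<le> m" "m < c" "m < n + 1" using bc m by auto
  have labels: "vertex_label n \<A> ` middle_triangle n \<A> T l = {?g b, l, ?g c}"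
    unfolding middle_triangle_eq[OF A T v l m arc bc] by (auto simp: arc_label_def l)
  have pos: "vertex_labelled n \<A> l = v" "vertex_labelled n \<A> (?g b) = ?r b"
    "vertex_labelled n \<A> (?g c) = ?r c"
    using v lt reflect_less[OF v] by (auto simp: l arc_label_def)
  have cw: "boundary_edges n \<A> l (?g b) Q = b"
    if "Q l" "\<And>y. y \<in> {1..m} \<Longrightarrow> Q (?g y)" "\<not> Q (?g (n + 1))" for Q
  proof (rule boundary_edges_clockwise[OF pos(1,2) v lt(1,2)])
    fix i assume "i \<le> b"
    then show "Q (vertex_label n \<A> (?r i))"
      using that(1) that(2)[of i] lt l by (cases "i = 0") (auto simp: arc_label_def)
  qed (use that in \<open>simp add: arc_label_def\<close>)
  have ccw: "boundary_edges n \<A> l (?g c) Q = n + 2 - c"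
    if "Q l" "\<And>y. y \<in> {m + 1..n + 1} \<Longrightarrow> Q (?g y)" "\<not> Q (?g 1)" for Q
  proof (rule boundary_edges_counterclockwise[OF pos(1,3) v lt(3,4)])
    fix i assume "c \<le> i" "i < n + 2"
    then show "Q (vertex_label n \<A> (?r i))"
      using that(2)[of i] lt by (auto simp: arc_label_def)
  qed (use that l in \<open>auto simp: arc_label_def\<close>)
  from arc show ?thesis
  proof
    assume below: "\<forall>y\<in>{1..<n + 2}. ?g y < l \<longleftrightarrow> y \<le> m"
    then have above: "l < ?g y \<longleftrightarrow> m < y" if "y \<in> {1..<n + 2}" for y
      using ne[OF that] that by (metis linorder_neqE_nat not_less not_less_iff_gr_or_eq)
    have "?g b < l" "l < ?g c" using below above lt by auto
    then have "Min {?g b, l, ?g c} = ?g b" "Max {?g b, l, ?g c} = ?g c" by auto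
    moreover have "boundary_edges n \<A> l (?g b) (\<lambda>i. i \<le> l) = b"
      by (rule cw) (use below above m in \<open>auto simp: less_imp_le not_le\<close>)
    moreover have "boundary_edges n \<A> l (?g c) (\<lambda>i. i \<ge> l) = n + 2 - c"
      by (rule ccw) (use below above m in \<open>auto simp: less_imp_le not_le\<close>)
    ultimately show ?thesis unfolding weight_def labels gw Let_def by simp
  next
    assume above: "\<forall>y\<in>{1..<n + 2}. l < ?g y \<longleftrightarrow> y \<le> m"
    then have below: "?g y < l \<longleftrightarrow> m < y" if "y \<in> {1..<n + 2}" for y
      using ne[OF that] that by (metis linorder_neqE_nat not_less not_less_iff_gr_or_eq)
    have "?g c < l" "l < ?g b" using below above lt by auto
    then have "Min {?g b, l, ?g c} = ?g c" "Max {?g b, l, ?g c} = ?g b" by auto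
    moreover have "boundary_edges n \<A> l (?g b) (\<lambda>i. i \<ge> l) = b"
      by (rule cw) (use below above m in \<open>auto simp: less_imp_le not_le\<close>)
    moreover have "boundary_edges n \<A> l (?g c) (\<lambda>i. i \<le> l) = n + 2 - c"
      by (rule ccw) (use below above m in \<open>auto simp: less_imp_le not_le\<close>)
    ultimately show ?thesis unfolding weight_def labels gw Let_def by simp
  qed
qed

section \<open>The center of gravity\<close>

lemma sum_weight:
  assumes A: "regular_polygon (n + 2) A" and l: "l \<in> {1..n}"
  shows "(\<Sum>T\<in>triangulations n A. real (weight n \<A> T l))
       = real (card (triangulations n A)) * (real n + 1) / 2"
proof -
  obtain v m where v: "v < n + 2" and lv: "l = vertex_label n \<A> v" and m: "m \<in> {1..n}"
    and arc: "(\<forall>y\<in>{1..<n + 2}. arc_label n \<A> v y < l \<longleftrightarrow> y \<le> m) \<or>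
              (\<forall>y\<in>{1..<n + 2}. l < arc_label n \<A> v y \<longleftrightarrow> y \<le> m)"
  proof (cases "l \<in> down_elements n \<A>")
    case True
    then obtain v where v: "v < Suc (card (down_elements n \<A>))" "vertex_label n \<A> v = l"
      by (rule down_vertex_exists)
    then show thesis
      using that[of v l] down_arc_label[OF v(1) v(2)[symmetric]] l card_down_up[of n \<A>] by simp
  next
    case False
    then have "l \<in> up_elements n \<A>" using l by (simp add: down_elements_def)
    then obtain v where v: "Suc (card (down_elements n \<A>)) < v" "v < n + 2" "vertex_label n \<A> v = l"
      by (rule up_vertex_exists)
    have "n + 1 - l \<in> {1..n}" using l by auto
    then show thesis
      using that[of v "n + 1 - l"] up_arc_label[OF v(1,2) v(3)[symmetric]] v by blast
  qed
  have "(\<Sum>T\<in>triangulations n A. real (weight n \<A> T l))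
      = (\<Sum>T\<in>triangulations n A. gap_weight n m (reflect_tri (n + 2) v T))"
    by (intro sum.cong refl weight_eq_gap_weight[OF A _ v lv m arc])
  also have "\<dots> = (\<Sum>T\<in>triangulations n A. gap_weight n m T)"
    by (rule sum_reflect_tri[OF A v])
  finally show ?thesis using sum_gap_weight[OF A m] by simp
qed

lemma sum_asso_coord:
  assumes "regular_polygon (n + 2) A" "l \<in> {1..n}"
  shows "(\<Sum>T\<in>triangulations n A. asso_coord n \<A> T l)
       = real (card (triangulations n A)) * (real n + 1) / 2"
proof (cases "l \<in> down_elements n \<A>")
  case True
  then show ?thesis using sum_weight[OF assms, of \<A>] by (simp add: asso_coord_def)
next
  case False
  then show ?thesis
    using sum_weight[OF assms, of \<A>] by (simp add: asso_coord_def sum_subtractf field_simps)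
qed

theorem theorem3p3:
  fixes n :: nat
    and idx :: "'n::finite \<Rightarrow> nat"
    and A :: "nat \<Rightarrow> complex"
    and \<A> :: orientation
    and G :: "real ^ 'n"
  assumes "n \<ge> 1"
    and "bij_betw idx UNIV {1..n}"
    and "regular_polygon (n + 2) A"
    and "orientation_of (coxeter_edges n) \<A>"
    and "G = (\<chi> i. (real n + 1) / 2)"
  shows "asso_center_of_gravity n A idx \<A> = G
       \<and> (\<Sum>T\<in>triangulations n A. asso_point n idx \<A> T - G) = 0"
proof
  have idx: "idx i \<in> {1..n}" for i using assms(2) by (auto simp: bij_betw_def)
  have sum: "(\<Sum>T\<in>triangulations n A. asso_point n idx \<A> T)
      = real (card (triangulations n A)) *\<^sub>R G"
    using sum_asso_coord[OF assms(3) idx, of \<A>] by (simp add: vec_eq_iff asso_point_def assms(5))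
  then show zero: "(\<Sum>T\<in>triangulations n A. asso_point n idx \<A> T - G) = 0"
    by (simp only: sum_subtractf sum_constant_scaleR diff_self)
  have "card (triangulations n A) \<noteq> 0"
    using fan_in_triangulations[OF assms(3)] by auto
  then show "asso_center_of_gravity n A idx \<A> = G"
    unfolding asso_center_of_gravity_def sum_subtractf sum_constant_scaleR sum
    by (intro the_equality) simp_all
qed

end
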